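(* Let $\mathcal{E}$ be a separable Hilbert space, let $\mathcal{E}_0$ be a total subset of $\mathcal{E}$ (i.e. its linear span is dense in $\mathcal{E}$), and let $\mathcal{H}_{\mathcal{E}}(K)$ be the analytic reproducing kernel Hilbert space corresponding to an analytic kernel $K:\mathbb{D}\times\mathbb{D}\to\mathcal{B}(\mathcal{E})$. Suppose that the multiplication operator $M_z$ is bounded on $\mathcal{H}_{\mathcal{E}}(K)$. Then the following hold. (1) If $$\liminf_{n}\left(\frac{1}{(n!)^2}\Big\langle\Big(\frac{\partial^{2n}K}{\partial z^n\partial\bar{w}^n}(0,0)\Big)\eta,\eta\Big\rangle_{\mathcal{E}}\right)=0$$ uniformly in $\eta\in\mathcal{E}_0$, then $M_z^*$ is hypercyclic. (2) If $$\lim_{n}\left(\frac{1}{(n!)^2}\Big\langle\Big(\frac{\partial^{2n}K}{\partial z^n\partial\bar{w}^n}(0,0)\Big)\eta,\eta\Big\rangle_{\mathcal{E}}\right)=0$$ for all $\eta\in\mathcal{E}_0$, then $M_z^*$ is topologically mixing.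
   Context: $\mathbb{D}$ is the open unit disc in $\mathbb{C}$; inner products are linear in the first variable. For a Hilbert space $\mathcal{E}$, a function $K:\mathbb{D}\times\mathbb{D}\to\mathcal{B}(\mathcal{E})$ is an analytic kernel if $K$ is analytic in the first variable and $\sum_{i,j=1}^n\langle K(z_i,z_j)\eta_j,\eta_i\rangle_{\mathcal{E}}\ge 0$ for all $n\in\mathbb{N}$, $z_1,\dots,z_n\in\mathbb{D}$, $\eta_1,\dots,\eta_n\in\mathcal{E}$. (Then $K(z,w)^*=K(w,z)$, so $K$ is co-analytic in $w$ and derivatives in $\bar w$ make sense.) The corresponding analytic reproducing kernel Hilbert space $\mathcal{H}_{\mathcal{E}}(K)$ is the Hilbert space of $\mathcal{E}$-valued analytic functions on $\mathbb{D}$ in which $\{K(\cdot,w)\eta: w\in\mathbb{D},\eta\in\mathcal{E}\}$ is total and $\langle f,K(\cdot,w)\eta\rangle_{\mathcal{H}_{\mathcal{E}}(K)}=\langle f(w),\eta\rangle_{\mathcal{E}}$ for all $f\in\mathcal{H}_{\mathcal{E}}(K)$, $w\in\mathbb{D}$, $\eta\in\mathcal{E}$. $M_z$ is the operator $(M_zf)(w)=wf(w)$; "$M_z$ is bounded on $\mathcal{H}_{\mathcal{E}}(K)$" means it maps this space into itself as a bounded operator, and $M_z^*$ is its adjoint. For a set $I$ and complex-valued functions $u_n$ on $I$, "$\liminf_n u_n(x)=0$ uniformly in $x\in I$" means that there is a (strictly increasing) subsequence $\{n_k\}$ of the natural numbers such that $\lim_{k\to\infty}u_{n_k}(x)=0$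 uniformly in $x\in I$. A bounded linear operator $T$ on a Banach space $X$ is hypercyclic if there is $x\in X$ with $\{x,Tx,T^2x,\dots\}$ dense in $X$; it is topologically mixing if for any two non-empty open sets $U,V\subseteq X$ there is $N\in\mathbb{N}$ with $T^{-j}(U)\cap V\neq\emptyset$ for all $j\ge N$. *)

theory Defs
  imports "HOL-Analysis.Analysis" "HOL-Library.Function_Algebras"
begin

section \<open>Complex vector spaces\<close>

class scaleC =
  fixes scaleC :: "complex \<Rightarrow> 'a \<Rightarrow> 'a"  (infixr \<open>*\<^sub>C\<close> 75)

class complex_vector = scaleC + ab_group_add +
  assumes scaleC_add_right: "a *\<^sub>C (x + y) = a *\<^sub>C x + a *\<^sub>C y"
    and scaleC_add_left: "(a + b) *\<^sub>C x = a *\<^sub>C x + b *\<^sub>C x"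
    and scaleC_scaleC: "a *\<^sub>C (b *\<^sub>C x) = (a * b) *\<^sub>C x"
    and scaleC_one: "1 *\<^sub>C x = x"

global_interpretation complex_vector:
  vector_space "scaleC :: complex \<Rightarrow> 'a \<Rightarrow> 'a::complex_vector"
  defines cspan = complex_vector.span
    and csubspace = complex_vector.subspace
  by unfold_locales (simp_all add: scaleC_add_right scaleC_add_left scaleC_scaleC scaleC_one)

class complex_normed_vector = complex_vector + real_normed_vector +
  assumes scaleR_scaleC: "r *\<^sub>R x = complex_of_real r *\<^sub>C x"
    and norm_scaleC: "norm (a *\<^sub>C x) = cmod a * norm x"

instantiation "fun" :: (type, complex_vector) complex_vector
begin

definition scaleC_fun :: "complex \<Rightarrow> ('a \<Rightarrow> 'b) \<Rightarrow> 'a \<Rightarrow> 'b"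
  where "scaleC_fun c f = (\<lambda>x. c *\<^sub>C f x)"

instance
  by standard
    (simp_all add: scaleC_fun_def fun_eq_iff scaleC_add_right scaleC_add_left scaleC_scaleC scaleC_one)

end

text \<open>
  The type \<open>'a \<Rightarrow>\<^sub>L 'b\<close> consists of the bounded \<^emph>\<open>real\<close>-linear maps. Scalars act on the values, so
  the complex-linear maps, singled out below by \<open>complex_homogeneous\<close>, form a closed complex
  subspace; for \<open>'a = 'b\<close> this subspace, with the operator norm, is the space of bounded operators.
\<close>

instantiation blinfun :: (real_normed_vector, complex_normed_vector) complex_normed_vector
begin

lift_definition scaleC_blinfun :: "complex \<Rightarrow> 'a \<Rightarrow>\<^sub>L 'b \<Rightarrow> 'a \<Rightarrow>\<^sub>L 'b"
  is "\<lambda>c f x. c *\<^sub>C f x"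
proof -
  fix c :: complex and f :: "'a \<Rightarrow> 'b"
  assume "bounded_linear f"
  moreover have "bounded_linear (\<lambda>y::'b. c *\<^sub>C y)"
    by (rule bounded_linear_intro [where K = "cmod c"])
      (simp_all add: scaleC_add_right scaleR_scaleC scaleC_scaleC norm_scaleC mult.commute)
  ultimately show "bounded_linear (\<lambda>x. c *\<^sub>C f x)"
    by (rule bounded_linear_compose [rotated])
qed

instance
proof
  fix a b :: complex and r :: real and x y :: "'a \<Rightarrow>\<^sub>L 'b"
  show "a *\<^sub>C (x + y) = a *\<^sub>C x + a *\<^sub>C y" by transfer (simp add: scaleC_add_right)
  show "(a + b) *\<^sub>C x = a *\<^sub>C x + b *\<^sub>C x" by transfer (simp add: scaleC_add_left)
  show "a *\<^sub>C b *\<^sub>C x = (a * b) *\<^sub>C x" by transfer (simp add: scaleC_scaleC)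
  show "1 *\<^sub>C x = x" by transfer (simp add: scaleC_one)
  show "r *\<^sub>R x = complex_of_real r *\<^sub>C x" by transfer (simp add: scaleR_scaleC)
  have "onorm (\<lambda>v. a *\<^sub>C f v) = onorm (\<lambda>v. cmod a *\<^sub>R f v)" for f :: "'a \<Rightarrow> 'b"
    by (simp add: onorm_def norm_scaleC)
  then show "norm (a *\<^sub>C x) = cmod a * norm x"
    by transfer (simp add: onorm_scaleR)
qed

end

definition complex_homogeneous :: "('a::complex_vector \<Rightarrow> 'b::complex_vector) \<Rightarrow> bool"
  where "complex_homogeneous T \<longleftrightarrow> (\<forall>c x. T (c *\<^sub>C x) = c *\<^sub>C T x)"

section \<open>Hilbert spaces\<close>

text \<open>The inner product is linear in the first variable. Its positive definiteness is contained in
  \<open>norm_eq_sqrt_cinner\<close> and the axioms of the norm.\<close>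

class complex_inner = complex_normed_vector +
  fixes cinner :: "'a \<Rightarrow> 'a \<Rightarrow> complex"
  assumes cinner_add_left: "cinner (x + y) z = cinner x z + cinner y z"
    and cinner_scaleC_left: "cinner (c *\<^sub>C x) y = c * cinner x y"
    and cinner_commute: "cinner x y = cnj (cinner y x)"
    and norm_eq_sqrt_cinner: "norm x = sqrt (Re (cinner x x))"

class chilbert_space = complex_inner + complete_space

instantiation complex :: chilbert_space
begin

definition scaleC_complex :: "complex \<Rightarrow> complex \<Rightarrow> complex"
  where "scaleC_complex a x = a * x"

definition cinner_complex :: "complex \<Rightarrow> complex \<Rightarrow> complex"
  where "cinner_complex x y = x * cnj y"

instance
proof
  fix a b x y z :: complex and r :: real
  show "a *\<^sub>C (x + y) = a *\<^sub>C x + a *\<^sub>C y" "(a + b) *\<^sub>C x = a *\<^sub>C x + b *\<^sub>C x"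
    "a *\<^sub>C b *\<^sub>C x = (a * b) *\<^sub>C x" "1 *\<^sub>C x = x"
    by (simp_all add: scaleC_complex_def distrib_left distrib_right)
  show "r *\<^sub>R x = complex_of_real r *\<^sub>C x" "norm (a *\<^sub>C x) = cmod a * norm x"
    by (simp_all add: scaleC_complex_def scaleR_conv_of_real norm_mult)
  show "cinner (x + y) z = cinner x z + cinner y z" "cinner (a *\<^sub>C x) y = a * cinner x y"
    "cinner x y = cnj (cinner y x)"
    by (simp_all add: cinner_complex_def scaleC_complex_def distrib_right)
  show "norm x = sqrt (Re (cinner x x))"
    by (simp add: cinner_complex_def complex_norm_square [symmetric] del: of_real_power)
qed

end

text \<open>
  A Hilbert space whose vectors form a subset \<open>S\<close> of an ambient vector space, with inner product
  \<open>ip\<close>. The locale \<open>Metric_space\<close> wants a distance that is nonnegative and symmetric on the whole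
  type, so \<open>ip_dist\<close> is set to 0 off \<open>S\<close>.
\<close>

definition ip_norm :: "('a \<Rightarrow> 'a \<Rightarrow> complex) \<Rightarrow> 'a \<Rightarrow> real"
  where "ip_norm ip x = sqrt (Re (ip x x))"

definition ip_dist :: "'a::ab_group_add set \<Rightarrow> ('a \<Rightarrow> 'a \<Rightarrow> complex) \<Rightarrow> 'a \<Rightarrow> 'a \<Rightarrow> real"
  where "ip_dist S ip x y = (if x \<in> S \<and> y \<in> S then ip_norm ip (x - y) else 0)"

abbreviation ip_topology :: "'a::ab_group_add set \<Rightarrow> ('a \<Rightarrow> 'a \<Rightarrow> complex) \<Rightarrow> 'a topology"
  where "ip_topology S ip \<equiv> Metric_space.mtopology S (ip_dist S ip)"

definition hilbert_space_on :: "'a::complex_vector set \<Rightarrow> ('a \<Rightarrow> 'a \<Rightarrow> complex) \<Rightarrow> bool"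
  where "hilbert_space_on S ip \<longleftrightarrow>
    csubspace S \<and>
    (\<forall>x\<in>S. \<forall>y\<in>S. \<forall>z\<in>S. ip (x + y) z = ip x z + ip y z) \<and>
    (\<forall>c. \<forall>x\<in>S. \<forall>y\<in>S. ip (c *\<^sub>C x) y = c * ip x y) \<and>
    (\<forall>x\<in>S. \<forall>y\<in>S. ip x y = cnj (ip y x)) \<and>
    (\<forall>x\<in>S. x \<noteq> 0 \<longrightarrow> 0 < Re (ip x x)) \<and>
    Metric_space.mcomplete S (ip_dist S ip)"

definition bounded_operator_on ::
    "'a::complex_vector set \<Rightarrow> ('a \<Rightarrow> 'a \<Rightarrow> complex) \<Rightarrow> ('a \<Rightarrow> 'a) \<Rightarrow> bool"
  where "bounded_operator_on S ip T \<longleftrightarrow>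
    (\<forall>x\<in>S. T x \<in> S) \<and>
    (\<forall>x\<in>S. \<forall>y\<in>S. T (x + y) = T x + T y) \<and>
    (\<forall>c. \<forall>x\<in>S. T (c *\<^sub>C x) = c *\<^sub>C T x) \<and>
    (\<exists>C. \<forall>x\<in>S. ip_norm ip (T x) \<le> C * ip_norm ip x)"

definition adjoint_on :: "'a set \<Rightarrow> ('a \<Rightarrow> 'a \<Rightarrow> complex) \<Rightarrow> ('a \<Rightarrow> 'a) \<Rightarrow> 'a \<Rightarrow> 'a"
  where "adjoint_on S ip T y = (THE y'. y' \<in> S \<and> (\<forall>x\<in>S. ip (T x) y = ip x y'))"

section \<open>Vector-valued analytic functions\<close>

text \<open>For the values in Banach spaces and the open sets used here, analyticity is complex
  differentiability at every point.\<close>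

definition vector_analytic_on :: "(complex \<Rightarrow> 'a::complex_normed_vector) \<Rightarrow> complex set \<Rightarrow> bool"
  where "vector_analytic_on f S \<longleftrightarrow>
    (\<forall>z\<in>S. \<exists>D. (f has_derivative (\<lambda>h. h *\<^sub>C D)) (at z))"

text \<open>\<open>deriv_z f z\<close> and \<open>deriv_zbar f z\<close> are the derivatives of an analytic, respectively a
  co-analytic, function in its variable, respectively in the conjugate of its variable.\<close>

definition deriv_z :: "(complex \<Rightarrow> 'a::complex_normed_vector) \<Rightarrow> complex \<Rightarrow> 'a"
  where "deriv_z f z = (THE D. (f has_derivative (\<lambda>h. h *\<^sub>C D)) (at z))"

definition deriv_zbar :: "(complex \<Rightarrow> 'a::complex_normed_vector) \<Rightarrow> complex \<Rightarrow> 'a"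
  where "deriv_zbar f z = (THE D. (f has_derivative (\<lambda>h. cnj h *\<^sub>C D)) (at z))"

definition mixed_deriv ::
    "nat \<Rightarrow> (complex \<Rightarrow> complex \<Rightarrow> 'a::complex_normed_vector) \<Rightarrow> complex \<Rightarrow> complex \<Rightarrow> 'a"
  where "mixed_deriv n K z w = (deriv_z ^^ n) (\<lambda>u. (deriv_zbar ^^ n) (\<lambda>v. K u v) w) z"

section \<open>Analytic kernels and their Hilbert spaces\<close>

abbreviation unit_disc :: "complex set"
  where "unit_disc \<equiv> ball 0 1"

definition analytic_kernel :: "(complex \<Rightarrow> complex \<Rightarrow> ('e::complex_inner \<Rightarrow>\<^sub>L 'e)) \<Rightarrow> bool"
  where "analytic_kernel K \<longleftrightarrow>
    (\<forall>z\<in>unit_disc. \<forall>w\<in>unit_disc. complex_homogeneous (blinfun_apply (K z w))) \<and>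
    (\<forall>w\<in>unit_disc. vector_analytic_on (\<lambda>z. K z w) unit_disc) \<and>
    (\<forall>n. \<forall>z :: nat \<Rightarrow> complex. \<forall>\<eta> :: nat \<Rightarrow> 'e. (\<forall>i<n. z i \<in> unit_disc) \<longrightarrow>
      (\<Sum>i<n. \<Sum>j<n. cinner (blinfun_apply (K (z i) (z j)) (\<eta> j)) (\<eta> i)) \<in> \<real>\<^sub>\<ge>\<^sub>0)"

text \<open>A function on the disc is represented by its extension by 0 to all of \<open>complex\<close>.\<close>

definition kernel_fun ::
    "(complex \<Rightarrow> complex \<Rightarrow> ('e::complex_inner \<Rightarrow>\<^sub>L 'e)) \<Rightarrow> complex \<Rightarrow> 'e \<Rightarrow> complex \<Rightarrow> 'e"
  where "kernel_fun K w \<eta> = (\<lambda>z. if z \<in> unit_disc then blinfun_apply (K z w) \<eta> else 0)"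

text \<open>\<open>analytic_rkhs K H ip\<close>: the set \<open>H\<close> with inner product \<open>ip\<close> is the analytic reproducing kernel
  Hilbert space of \<open>K\<close>, which these conditions determine uniquely.\<close>

definition analytic_rkhs ::
    "(complex \<Rightarrow> complex \<Rightarrow> ('e::complex_inner \<Rightarrow>\<^sub>L 'e)) \<Rightarrow>
     (complex \<Rightarrow> 'e) set \<Rightarrow> ((complex \<Rightarrow> 'e) \<Rightarrow> (complex \<Rightarrow> 'e) \<Rightarrow> complex) \<Rightarrow> bool"
  where "analytic_rkhs K H ip \<longleftrightarrow>
    hilbert_space_on H ip \<and>
    (\<forall>f\<in>H. vector_analytic_on f unit_disc \<and> (\<forall>z. z \<notin> unit_disc \<longrightarrow> f z = 0)) \<and>
    {kernel_fun K w \<eta> | w \<eta>. w \<in> unit_disc} \<subseteq> H \<and>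
    ip_topology H ip closure_of (cspan {kernel_fun K w \<eta> | w \<eta>. w \<in> unit_disc}) = H \<and>
    (\<forall>f\<in>H. \<forall>w\<in>unit_disc. \<forall>\<eta>. ip f (kernel_fun K w \<eta>) = cinner (f w) \<eta>)"

definition mult_z :: "(complex \<Rightarrow> 'e::complex_vector) \<Rightarrow> complex \<Rightarrow> 'e"
  where "mult_z f = (\<lambda>w. w *\<^sub>C f w)"

section \<open>Uniform lower limits and dynamics\<close>

definition liminf_zero_uniformly_on :: "'i set \<Rightarrow> (nat \<Rightarrow> 'i \<Rightarrow> complex) \<Rightarrow> bool"
  where "liminf_zero_uniformly_on I u \<longleftrightarrow>
    (\<exists>r :: nat \<Rightarrow> nat. strict_mono r \<and> uniform_limit I (\<lambda>k. u (r k)) (\<lambda>_. 0) sequentially)"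

definition hypercyclic_on :: "'a topology \<Rightarrow> ('a \<Rightarrow> 'a) \<Rightarrow> bool"
  where "hypercyclic_on X T \<longleftrightarrow>
    (\<exists>x\<in>topspace X. X closure_of {(T ^^ n) x | n. True} = topspace X)"

definition topologically_mixing_on :: "'a topology \<Rightarrow> ('a \<Rightarrow> 'a) \<Rightarrow> bool"
  where "topologically_mixing_on X T \<longleftrightarrow>
    (\<forall>U V. openin X U \<and> openin X V \<and> U \<noteq> {} \<and> V \<noteq> {} \<longrightarrow>
      (\<exists>N. \<forall>j\<ge>N. {x \<in> topspace X. (T ^^ j) x \<in> U} \<inter> V \<noteq> {}))"

end

theory Submission
  imports Defs "HOL-Complex_Analysis.Cauchy_Integral_Formula"
begin

text \<open>
  Let \<open>k n \<eta>\<close> (\<open>coef_rep n \<eta>\<close> below) represent the functional taking \<open>f\<close> to the inner product of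
  its \<open>n\<close>-th Taylor coefficient at 0 with \<open>\<eta>\<close>. The adjoint \<open>T\<close> of multiplication by
  \<open>z\<close> shifts these vectors backwards: it maps \<open>k (n + 1) \<eta>\<close> to \<open>k n \<eta>\<close> and \<open>k 0 \<eta>\<close> to 0. The quantity in the hypotheses is the squared norm of
  \<open>k n \<eta>\<close>, and the vectors \<open>k n \<eta>\<close> with \<open>\<eta> \<in> E0\<close> are total because an analytic function with zero
  Taylor coefficients vanishes. So on their dense span every \<open>T\<close>-orbit ends in 0, and every vector has
  \<open>T\<^sup>j\<close>-preimages that tend to 0 along the given sequence of exponents, as in Kitai's criterion. This
  gives mixing and transitivity respectively; transitivity implies hypercyclicity by Birkhoff's
  category argument, the space being separable.
\<close>

section \<open>Inner product spaces on a set\<close>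

text \<open>The function space is a set with its own inner product rather than a type, so
  projection, Riesz representation, uniform boundedness and adjoints are built over a carrier set.
  The analytic obstacle is that \<open>mixed_deriv\<close> iterates definite descriptions of
  operator-norm derivatives: it carries information only once \<open>K u (cnj v)\<close> as a
  function of \<open>v\<close>, and then its derivative at 0 as a function of \<open>u\<close>, are
  known to be norm-analytic. Testing against matrix entries yields scalar holomorphy, but the
  passage to norm-analyticity also needs local norm bounds, and these are not part of separate
  analyticity. They come from the space itself: each member is continuous, hence bounded on smaller
  closed discs, and uniform boundedness turns this into bounds for point evaluations, then for
  kernel functions and for the Taylor functionals at 0.\<close>

locale ip_space =
  fixes S :: "'a::complex_vector set" and ip :: "'a \<Rightarrow> 'a \<Rightarrow> complex"
  assumes carrier_subspace: "csubspace S"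
    and ip_add_left: "\<lbrakk>x \<in> S; y \<in> S; z \<in> S\<rbrakk> \<Longrightarrow> ip (x + y) z = ip x z + ip y z"
    and ip_scale_left: "\<lbrakk>x \<in> S; y \<in> S\<rbrakk> \<Longrightarrow> ip (c *\<^sub>C x) y = c * ip x y"
    and ip_commute: "\<lbrakk>x \<in> S; y \<in> S\<rbrakk> \<Longrightarrow> ip x y = cnj (ip y x)"
    and ip_pos: "\<lbrakk>x \<in> S; x \<noteq> 0\<rbrakk> \<Longrightarrow> 0 < Re (ip x x)"
begin

abbreviation nrm :: "'a \<Rightarrow> real" where "nrm \<equiv> ip_norm ip"

lemma zero_mem [simp]: "0 \<in> S"
  using complex_vector.subspace_0 carrier_subspace .

lemma add_mem [simp]: "\<lbrakk>x \<in> S; y \<in> S\<rbrakk> \<Longrightarrow> x + y \<in> S"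
  using complex_vector.subspace_add carrier_subspace by blast

lemma diff_mem [simp]: "\<lbrakk>x \<in> S; y \<in> S\<rbrakk> \<Longrightarrow> x - y \<in> S"
  using complex_vector.subspace_diff carrier_subspace by blast

lemma scale_mem [simp]: "x \<in> S \<Longrightarrow> c *\<^sub>C x \<in> S"
  using complex_vector.subspace_scale carrier_subspace by blast

lemma span_mem: "G \<subseteq> S \<Longrightarrow> cspan G \<subseteq> S"
  using complex_vector.span_minimal carrier_subspace by blast

lemma ip_zero_left [simp]: "y \<in> S \<Longrightarrow> ip 0 y = 0"
  using ip_scale_left[of 0 y 0] by simp

lemma ip_diff_left: "\<lbrakk>x \<in> S; y \<in> S; z \<in> S\<rbrakk> \<Longrightarrow> ip (x - y) z = ip x z - ip y z"
  using ip_add_left[of "x - y" y z] by simp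

lemma ip_add_right: "\<lbrakk>x \<in> S; y \<in> S; z \<in> S\<rbrakk> \<Longrightarrow> ip z (x + y) = ip z x + ip z y"
  by (metis add_mem complex_cnj_add ip_add_left ip_commute)

lemma ip_diff_right: "\<lbrakk>x \<in> S; y \<in> S; z \<in> S\<rbrakk> \<Longrightarrow> ip z (x - y) = ip z x - ip z y"
  by (metis complex_cnj_diff diff_mem ip_commute ip_diff_left)

lemma ip_scale_right: "\<lbrakk>x \<in> S; y \<in> S\<rbrakk> \<Longrightarrow> ip x (c *\<^sub>C y) = cnj c * ip x y"
  by (metis complex_cnj_mult ip_commute ip_scale_left scale_mem)

lemma ip_zero_right [simp]: "y \<in> S \<Longrightarrow> ip y 0 = 0"
  using ip_commute[of y 0] by simp

lemma ip_eqI: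
  assumes "x \<in> S" "y \<in> S" "\<And>z. z \<in> S \<Longrightarrow> ip z x = ip z y"
  shows "x = y"
proof (rule ccontr)
  assume "x \<noteq> y"
  then have "0 < Re (ip (x - y) (x - y))"
    using ip_pos[of "x - y"] assms by simp
  then show False
    using assms(3)[of "x - y"] assms(1,2) ip_diff_right[of x y "x - y"] by simp
qed

lemma Re_ip_nonneg: "x \<in> S \<Longrightarrow> 0 \<le> Re (ip x x)"
  using ip_pos[of x] by (cases "x = 0") auto

lemma ip_self: "x \<in> S \<Longrightarrow> ip x x = of_real ((nrm x)\<^sup>2)"
  using ip_commute[of x x] Re_ip_nonneg[of x]
  by (simp add: ip_norm_def complex_eq_iff)

lemma nrm_nonneg [simp]: "x \<in> S \<Longrightarrow> 0 \<le> nrm x"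
  by (simp add: ip_norm_def Re_ip_nonneg)

lemma nrm_zero [simp]: "nrm 0 = 0"
  by (simp add: ip_norm_def)

lemma nrm_eq_0: "x \<in> S \<Longrightarrow> nrm x = 0 \<longleftrightarrow> x = 0"
  using ip_pos[of x] by (cases "x = 0") (auto simp: ip_norm_def)

lemma nrm_scale: "x \<in> S \<Longrightarrow> nrm (c *\<^sub>C x) = cmod c * nrm x"
proof -
  assume x: "x \<in> S"
  have "ip (c *\<^sub>C x) (c *\<^sub>C x) = c * cnj c * ip x x"
    using x by (simp add: ip_scale_left ip_scale_right)
  also have "\<dots> = of_real ((cmod c)\<^sup>2 * (nrm x)\<^sup>2)"
    using x by (simp only: ip_self complex_norm_square[symmetric] of_real_mult)
  finally have "nrm (c *\<^sub>C x) = sqrt ((cmod c * nrm x)\<^sup>2)"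
    by (simp only: ip_norm_def Re_complex_of_real power_mult_distrib)
  then show ?thesis using x by simp
qed

lemma nrm_uminus: "x \<in> S \<Longrightarrow> nrm (- x) = nrm x"
  using nrm_scale[of x "-1"] by simp

lemma nrm_diff_commute: "\<lbrakk>x \<in> S; y \<in> S\<rbrakk> \<Longrightarrow> nrm (x - y) = nrm (y - x)"
  using nrm_uminus[of "x - y"] by simp

lemma nrm_add_sq:
  assumes "x \<in> S" "y \<in> S"
  shows "(nrm (x + y))\<^sup>2 = (nrm x)\<^sup>2 + 2 * Re (ip x y) + (nrm y)\<^sup>2"
proof -
  have "ip (x + y) (x + y) = ip x x + ip x y + (cnj (ip x y) + ip y y)"
    using assms ip_commute[of y x] by (simp add: ip_add_left ip_add_right)
  then have "Re (ip (x + y) (x + y)) = Re (ip x x) + 2 * Re (ip x y) + Re (ip y y)"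
    by simp
  then show ?thesis
    using assms by (simp add: ip_self del: of_real_power)
qed

lemma nrm_diff_sq:
  assumes "x \<in> S" "y \<in> S"
  shows "(nrm (x - y))\<^sup>2 = (nrm x)\<^sup>2 - 2 * Re (ip x y) + (nrm y)\<^sup>2"
proof -
  have "ip x (- y) = - ip x y"
    using ip_scale_right[of x y "-1"] assms by simp
  moreover have "- y \<in> S"
    using scale_mem[of y "-1"] assms by simp
  ultimately show ?thesis
    using nrm_add_sq[of x "- y"] assms by (simp add: nrm_uminus)
qed

lemma parallelogram:
  assumes "x \<in> S" "y \<in> S"
  shows "(nrm (x + y))\<^sup>2 + (nrm (x - y))\<^sup>2 = 2 * (nrm x)\<^sup>2 + 2 * (nrm y)\<^sup>2"
  by (simp add: nrm_add_sq nrm_diff_sq assms)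

lemma Cauchy_Schwarz:
  assumes "x \<in> S" "y \<in> S"
  shows "cmod (ip x y) \<le> nrm x * nrm y"
proof (cases "y = 0")
  case False
  define a where "a = ip x y"
  define b where "b = (nrm y)\<^sup>2"
  have b: "0 < b"
    using nrm_eq_0[of y] assms False by (simp add: b_def)
  have "ip (of_real b *\<^sub>C x) (a *\<^sub>C y) = of_real b * (a * cnj a)"
    using assms by (simp add: ip_scale_left ip_scale_right a_def)
  then have Re: "Re (ip (of_real b *\<^sub>C x) (a *\<^sub>C y)) = b * (cmod a)\<^sup>2"
    by (simp only: complex_norm_square[symmetric] Re_complex_of_real flip: of_real_mult)
  \<comment> \<open>This is x minus its projection onto y, multiplied by \<open>b\<close> to avoid a
    division; one factor \<open>b\<close> is cancelled at the end.\<close>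
  have "0 \<le> (nrm (of_real b *\<^sub>C x - a *\<^sub>C y))\<^sup>2" by simp
  also have "\<dots> = b\<^sup>2 * (nrm x)\<^sup>2 - 2 * (b * (cmod a)\<^sup>2) + (cmod a)\<^sup>2 * b"
    using assms Re b by (simp add: nrm_diff_sq nrm_scale power_mult_distrib flip: b_def)
  also have "\<dots> = b * (b * (nrm x)\<^sup>2 - (cmod a)\<^sup>2)"
    by (simp add: power2_eq_square right_diff_distrib)
  finally have "(cmod a)\<^sup>2 \<le> b * (nrm x)\<^sup>2"
    using b by (simp add: zero_le_mult_iff)
  then have "(cmod a)\<^sup>2 \<le> (nrm x * nrm y)\<^sup>2"
    by (simp only: b_def power_mult_distrib mult.commute)
  then show ?thesis
    unfolding a_def by (rule power2_le_imp_le) (use assms in simp)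
qed (use assms in simp)

lemma nrm_triangle:
  assumes "x \<in> S" "y \<in> S"
  shows "nrm (x + y) \<le> nrm x + nrm y"
proof -
  have "Re (ip x y) \<le> nrm x * nrm y"
    by (rule order_trans[OF complex_Re_le_cmod Cauchy_Schwarz[OF assms]])
  then have "(nrm (x + y))\<^sup>2 \<le> (nrm x + nrm y)\<^sup>2"
    unfolding nrm_add_sq[OF assms] by (simp add: power2_sum)
  then show ?thesis
    by (rule power2_le_imp_le) (use assms in simp)
qed

lemma nrm_triangle_diff:
  assumes "x \<in> S" "y \<in> S" "z \<in> S"
  shows "nrm (x - z) \<le> nrm (x - y) + nrm (y - z)"
  using nrm_triangle[of "x - y" "y - z"] assms by simp

sublocale Metric_space S "ip_dist S ip"
proof
  fix x y z
  show "0 \<le> ip_dist S ip x y" by (simp add: ip_dist_def)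
  show "ip_dist S ip x y = ip_dist S ip y x"
    by (simp add: ip_dist_def nrm_diff_commute)
  assume "x \<in> S" "y \<in> S"
  then show "ip_dist S ip x y = 0 \<longleftrightarrow> x = y" by (simp add: ip_dist_def nrm_eq_0)
  assume "z \<in> S"
  with \<open>x \<in> S\<close> \<open>y \<in> S\<close> show "ip_dist S ip x z \<le> ip_dist S ip x y + ip_dist S ip y z"
    by (simp add: ip_dist_def nrm_triangle_diff)
qed

lemma dist_eq: "\<lbrakk>x \<in> S; y \<in> S\<rbrakk> \<Longrightarrow> ip_dist S ip x y = nrm (x - y)"
  by (simp add: ip_dist_def)

text \<open>Lets later arguments about open sets work with the norm alone, away from the default
  value of \<open>ip_dist\<close> off \<open>S\<close>.\<close>

lemma openin_iff_nrm:
  "openin mtopology U \<longleftrightarrow> U \<subseteq> S \<and> (\<forall>x\<in>U. \<exists>e>0. \<forall>y\<in>S. nrm (y - x) < e \<longrightarrow> y \<in> U)"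
proof -
  have "mball x r \<subseteq> U \<longleftrightarrow> (\<forall>y\<in>S. nrm (y - x) < r \<longrightarrow> y \<in> U)" if "U \<subseteq> S" "x \<in> U" for x r
  proof -
    have "y \<in> mball x r \<longleftrightarrow> y \<in> S \<and> nrm (y - x) < r" for y
      using that by (auto simp: dist_eq nrm_diff_commute[of x])
    then show ?thesis by blast
  qed
  then show ?thesis
    unfolding openin_mtopology by blast
qed

lemma closure_of_iff_nrm:
  assumes "A \<subseteq> S"
  shows "x \<in> mtopology closure_of A \<longleftrightarrow> x \<in> S \<and> (\<forall>e>0. \<exists>y\<in>A. nrm (x - y) < e)"
proof -
  have "y \<in> mball x e \<longleftrightarrow> nrm (x - y) < e" if "x \<in> S" "y \<in> A" for e y
    using that assms by (auto simp: dist_eq)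
  then show ?thesis
    unfolding metric_closure_of by auto
qed

end

lemma ip_space_if_hilbert_space_on:
  assumes "hilbert_space_on S ip" shows "ip_space S ip"
  using assms unfolding hilbert_space_on_def by unfold_locales blast+

section \<open>Completeness: minimal vectors, Riesz representation, dense spans\<close>

locale hilbert = ip_space +
  assumes mcomplete: "mcomplete"
begin

lemma Cauchy_convergent:
  assumes "range X \<subseteq> S" "\<And>e. e > 0 \<Longrightarrow> \<exists>N. \<forall>m\<ge>N. \<forall>n\<ge>N. nrm (X m - X n) < e"
  obtains x where "x \<in> S" "(\<lambda>n. nrm (X n - x)) \<longlonglongrightarrow> 0"
proof -
  have mem: "X n \<in> S" for n using assms(1) by blast
  have "MCauchy X"
    unfolding MCauchy_def using assms by (auto simp: dist_eq mem)
  then obtain x where "limitin mtopology X x sequentially"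
    using mcomplete mcomplete_def by blast
  then have x: "x \<in> S" "\<And>e. e > 0 \<Longrightarrow> \<exists>N. \<forall>n\<ge>N. ip_dist S ip (X n) x < e"
    unfolding limit_metric_sequentially by blast+
  have "(\<lambda>n. nrm (X n - x)) \<longlonglongrightarrow> 0"
    using x by (intro LIMSEQ_I) (auto simp: dist_eq mem)
  with x(1) show ?thesis using that by blast
qed

text \<open>Common core of Riesz representation and of the density of spans. A norm-minimizing
  sequence in a midpoint-closed set is Cauchy, and its limit is orthogonal to every direction
  \<open>L\<close> along which the set may be translated. \<open>A\<close> need not be closed, so
  the limit is only asserted to be approximable from \<open>A\<close>.\<close>

lemma minimal_distance:
  assumes "A \<subseteq> S" "A \<noteq> {}"
    and mid: "\<And>x y. \<lbrakk>x \<in> A; y \<in> A\<rbrakk> \<Longrightarrow> (1/2) *\<^sub>C (x + y) \<in> A"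
    and L: "L \<subseteq> S" "\<And>c l. l \<in> L \<Longrightarrow> c *\<^sub>C l \<in> L" "\<And>x l. \<lbrakk>x \<in> A; l \<in> L\<rbrakk> \<Longrightarrow> x + l \<in> A"
  obtains x where "x \<in> S" "\<And>e. e > 0 \<Longrightarrow> \<exists>a\<in>A. nrm (a - x) < e" "\<And>l. l \<in> L \<Longrightarrow> ip l x = 0"
proof -
  define d where "d = (INF a\<in>A. (nrm a)\<^sup>2)"
  have bdd: "bdd_below ((\<lambda>a. (nrm a)\<^sup>2) ` A)"
    by (rule bdd_belowI2[where m = 0]) simp
  have dle: "d \<le> (nrm a)\<^sup>2" if "a \<in> A" for a
    unfolding d_def using bdd that by (rule cINF_lower)
  have "\<exists>a\<in>A. (nrm a)\<^sup>2 < d + e" if "e > 0" for e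
    using cInf_lessD[of "(\<lambda>a. (nrm a)\<^sup>2) ` A" "d + e"] that assms(2) by (auto simp: d_def)
  then have "\<forall>n. \<exists>a\<in>A. (nrm a)\<^sup>2 < d + 1 / real (Suc n)" by simp
  then obtain X where X: "\<And>n. X n \<in> A" "\<And>n. (nrm (X n))\<^sup>2 < d + 1 / real (Suc n)"
    by metis
  have XS: "X n \<in> S" for n using X assms(1) by blast
  \<comment> \<open>The midpoint lies in \<open>A\<close>, so its squared norm is at least
    \<open>d\<close>; the parallelogram law then cancels \<open>4 * d\<close>.\<close>
  have close: "(nrm (X m - X n))\<^sup>2 \<le> 2 / real (Suc m) + 2 / real (Suc n)" for m n
  proof -
    have "d \<le> (nrm ((1/2) *\<^sub>C (X m + X n)))\<^sup>2" by (intro dle mid X)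
    also have "\<dots> = (nrm (X m + X n))\<^sup>2 / 4"
      using XS by (simp add: nrm_scale power_divide)
    finally have "4 * d \<le> (nrm (X m + X n))\<^sup>2" by simp
    with parallelogram[OF XS[of m] XS[of n]] X(2)[of m] X(2)[of n] show ?thesis by linarith
  qed
  obtain x where x: "x \<in> S" "(\<lambda>n. nrm (X n - x)) \<longlonglongrightarrow> 0"
  proof (rule Cauchy_convergent)
    show "range X \<subseteq> S" using XS by blast
    fix e :: real assume e: "e > 0"
    \<comment> \<open>Each of the two terms 2 / (n + 1) in \<open>close\<close> is then below half
      of the square of \<open>e\<close>.\<close>
    then obtain N where N: "1 / real (Suc N) < e\<^sup>2 / 4"
      using nat_approx_posE[of "e\<^sup>2 / 4"] by auto
    have "nrm (X m - X n) < e" if "m \<ge> N" "n \<ge> N" for m n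
    proof -
      have "1 / real (Suc m) \<le> 1 / real (Suc N)" "1 / real (Suc n) \<le> 1 / real (Suc N)"
        using that by (simp_all add: frac_le)
      then have "(nrm (X m - X n))\<^sup>2 < e\<^sup>2" using close[of m n] N by linarith
      then show ?thesis by (rule power2_less_imp_less) (use e in simp)
    qed
    then show "\<exists>N. \<forall>m\<ge>N. \<forall>n\<ge>N. nrm (X m - X n) < e" by blast
  qed
  have "\<exists>a\<in>A. nrm (a - x) < e" if e: "e > 0" for e
    using order_tendstoD(2)[OF x(2) e] X(1) by (auto simp: eventually_sequentially)
  moreover have "ip l x = 0" if l: "l \<in> L" for l
  proof (rule ccontr)
    assume nz: "ip l x \<noteq> 0"
    have lS: "l \<in> S" using l L by blast
    with nz x have "l \<noteq> 0" by auto
    then have nl: "0 < nrm l" using nrm_eq_0[of l] nrm_nonneg[of l] lS by linarith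
    \<comment> \<open>\<open>c *\<^sub>C l\<close> is the projection of \<open>x\<close> onto the
      line through \<open>l\<close>, and \<open>q\<close> below is its length; subtracting it would
      lower the squared norm by \<open>q\<^sup>2\<close>, below the minimum.\<close>
    define c where "c = ip x l / of_real ((nrm l)\<^sup>2)"
    define q where "q = cmod (ip l x) / nrm l"
    have q: "q > 0" using nz nl by (simp add: q_def)
    have cm: "cmod (ip x l) = cmod (ip l x)"
      using ip_commute[OF x(1) lS] by simp
    have "cnj c * ip x l = (ip x l * cnj (ip x l)) / of_real ((nrm l)\<^sup>2)"
      by (simp add: c_def)
    also have "\<dots> = of_real (q\<^sup>2)"
      by (simp only: complex_norm_square[symmetric] q_def power_divide of_real_divide cm)
    finally have "cnj c * ip x l = of_real (q\<^sup>2)" .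
    moreover have "cmod c * nrm l = q"
      using nl cm by (simp add: c_def q_def norm_divide norm_mult norm_power power2_eq_square)
    ultimately have sq: "(nrm (x - c *\<^sub>C l))\<^sup>2 = (nrm x)\<^sup>2 - q\<^sup>2"
      using x lS by (simp add: nrm_diff_sq ip_scale_right nrm_scale del: of_real_power)
    \<comment> \<open>The lower bound \<open>d\<close> holds on \<open>A\<close> only, which may
      miss \<open>x - c *\<^sub>C l\<close>; it is carried over from
      \<open>X n - c *\<^sub>C l\<close> by continuity of the norm.\<close>
    have lim: "(\<lambda>n. nrm (X n - y)) \<longlonglongrightarrow> nrm (x - y)" if y: "y \<in> S" for y
    proof (rule tendsto_sandwich[where f = "\<lambda>n. nrm (x - y) - nrm (X n - x)"
            and h = "\<lambda>n. nrm (x - y) + nrm (X n - x)"])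
      have "nrm (x - y) - nrm (X n - x) \<le> nrm (X n - y)"
        "nrm (X n - y) \<le> nrm (x - y) + nrm (X n - x)" for n
        using nrm_triangle_diff[OF x(1) XS[of n] y] nrm_triangle_diff[OF XS[of n] x(1) y]
          nrm_diff_commute[OF x(1) XS[of n]] by linarith+
      then show "\<forall>\<^sub>F n in sequentially. nrm (x - y) - nrm (X n - x) \<le> nrm (X n - y)"
        "\<forall>\<^sub>F n in sequentially. nrm (X n - y) \<le> nrm (x - y) + nrm (X n - x)" by auto
      show "(\<lambda>n. nrm (x - y) - nrm (X n - x)) \<longlonglongrightarrow> nrm (x - y)"
        using tendsto_diff[OF tendsto_const x(2)] by simp
      show "(\<lambda>n. nrm (x - y) + nrm (X n - x)) \<longlonglongrightarrow> nrm (x - y)"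
        using tendsto_add[OF tendsto_const x(2)] by simp
    qed
    have "X n - c *\<^sub>C l \<in> A" for n
      using L(3)[OF X(1) L(2)[OF l, of "- c"]] by simp
    then have "d \<le> (nrm (X n - c *\<^sub>C l))\<^sup>2" for n by (rule dle)
    then have 1: "d \<le> (nrm (x - c *\<^sub>C l))\<^sup>2"
      using lS by (intro LIMSEQ_le_const[OF tendsto_power[OF lim]]) auto
    have "(\<lambda>n. d + 1 / real (Suc n)) \<longlonglongrightarrow> d"
      using tendsto_add[OF tendsto_const LIMSEQ_inverse_real_of_nat, of d] by (simp add: inverse_eq_divide)
    moreover have "(\<lambda>n. (nrm (X n))\<^sup>2) \<longlonglongrightarrow> (nrm x)\<^sup>2"
      using tendsto_power[OF lim[OF zero_mem]] by simp
    ultimately have "(nrm x)\<^sup>2 \<le> d"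
      using X(2) by (intro LIMSEQ_le) (auto intro: less_imp_le)
    with 1 sq q show False by (smt (verit) zero_less_power)
  qed
  ultimately show ?thesis using that x(1) by blast
qed

text \<open>A minimal vector y of the level set \<phi> = 1 is orthogonal to the kernel of \<phi>.
  Splitting x into a kernel part and \<phi>(x) y shows that y divided by its squared norm represents
  \<phi>.\<close>

lemma Riesz:
  assumes add: "\<And>x y. \<lbrakk>x \<in> S; y \<in> S\<rbrakk> \<Longrightarrow> \<phi> (x + y) = \<phi> x + \<phi> y"
    and scale: "\<And>c x. x \<in> S \<Longrightarrow> \<phi> (c *\<^sub>C x) = c * \<phi> x"
    and bound: "\<And>x. x \<in> S \<Longrightarrow> cmod (\<phi> x) \<le> C * nrm x"
  shows "\<exists>y\<in>S. \<forall>x\<in>S. \<phi> x = ip x y"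
proof (cases "\<forall>x\<in>S. \<phi> x = 0")
  case False
  then obtain x1 where x1: "x1 \<in> S" "\<phi> x1 \<noteq> 0" by blast
  define A where "A = {x \<in> S. \<phi> x = 1}"
  define L where "L = {x \<in> S. \<phi> x = 0}"
  have diff: "\<phi> (x - y) = \<phi> x - \<phi> y" if "x \<in> S" "y \<in> S" for x y
    using add[of "x - y" y] that by simp
  have "(1 / \<phi> x1) *\<^sub>C x1 \<in> A" using x1 by (simp add: A_def scale)
  then obtain y where y: "y \<in> S" "\<And>e. e > 0 \<Longrightarrow> \<exists>a\<in>A. nrm (a - y) < e"
      "\<And>l. l \<in> L \<Longrightarrow> ip l y = 0"
    by (rule_tac minimal_distance[of A L]) (auto simp: A_def L_def add scale)
  have "cmod (\<phi> y - 1) \<le> e" if e: "e > 0" for e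
  proof -
    \<comment> \<open>The level set is only approached by \<open>y\<close>, so \<phi>(y) = 1 comes
      from continuity. \<open>\<bar>C\<bar> + 1\<close> is positive whatever the sign of
      \<open>C\<close>.\<close>
    have "e / (\<bar>C\<bar> + 1) > 0" using e by (simp add: add_pos_nonneg)
    then obtain a where a: "a \<in> A" "nrm (a - y) < e / (\<bar>C\<bar> + 1)" using y(2) by blast
    then have aS: "a \<in> S" "\<phi> a = 1" by (auto simp: A_def)
    have "cmod (\<phi> y - 1) = cmod (\<phi> (a - y))"
      using y(1) aS by (simp add: diff norm_minus_commute)
    also have "\<dots> \<le> C * nrm (a - y)" using bound y(1) aS by simp
    also have "\<dots> \<le> (\<bar>C\<bar> + 1) * nrm (a - y)"
      using y(1) aS by (intro mult_right_mono) auto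
    also have "\<dots> \<le> e" using a(2) by (simp add: field_simps add_pos_nonneg)
    finally show ?thesis .
  qed
  then have \<phi>y: "\<phi> y = 1"
    using field_le_epsilon[of "cmod (\<phi> y - 1)" 0] by simp
  then have "y \<noteq> 0" using scale[of 0 0] by auto
  then have ny: "nrm y \<noteq> 0" using y nrm_eq_0 by blast
  show ?thesis
  proof (intro bexI ballI)
    show "of_real (1 / (nrm y)\<^sup>2) *\<^sub>C y \<in> S" using y by simp
    fix x assume x: "x \<in> S"
    have "x - \<phi> x *\<^sub>C y \<in> L" using x y \<phi>y by (simp add: L_def diff scale)
    then have "ip (x - \<phi> x *\<^sub>C y) y = 0" by (rule y)
    then have "ip x y = \<phi> x * of_real ((nrm y)\<^sup>2)"
      using x y by (simp add: ip_diff_left ip_scale_left ip_self)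
    then show "\<phi> x = ip x (of_real (1 / (nrm y)\<^sup>2) *\<^sub>C y)"
      using x y ny by (simp add: ip_scale_right)
  qed
qed (intro bexI[of _ 0], auto)

text \<open>The minimal vector of x - span G is orthogonal to \<open>G\<close>, hence 0, so x - span
  G comes arbitrarily close to 0.\<close>

lemma span_dense:
  assumes G: "G \<subseteq> S" and "\<And>x. \<lbrakk>x \<in> S; \<And>g. g \<in> G \<Longrightarrow> ip x g = 0\<rbrakk> \<Longrightarrow> x = 0"
    and x: "x \<in> S" and e: "e > 0"
  shows "\<exists>y\<in>cspan G. nrm (x - y) < e"
proof -
  have GS: "cspan G \<subseteq> S" using span_mem[OF G] .
  define A where "A = (\<lambda>y. x - y) ` cspan G"
  have "(1/2) *\<^sub>C ((x - y) + (x - z)) = x - (1/2) *\<^sub>C (y + z)" for y z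
  proof -
    have "(1/2::complex) *\<^sub>C (x + x) = x"
      by (simp add: scaleC_add_right scaleC_one flip: scaleC_add_left)
    then show ?thesis
      by (simp add: complex_vector.scale_right_diff_distrib scaleC_add_right algebra_simps)
  qed
  then have mid: "(1/2) *\<^sub>C (a + b) \<in> A" if "a \<in> A" "b \<in> A" for a b
    using that unfolding A_def
    by (auto intro!: imageI complex_vector.span_scale complex_vector.span_add)
  have shift: "a + l \<in> A" if a: "a \<in> A" and l: "l \<in> cspan G" for a l
  proof -
    obtain y where "y \<in> cspan G" "a = x - y" using a by (auto simp: A_def)
    then have "a + l = x - (y - l)" "y - l \<in> cspan G"
      using l by (auto intro: complex_vector.span_diff)
    then show ?thesis unfolding A_def by blast
  qed
  obtain u where u: "u \<in> S" "\<And>e. e > 0 \<Longrightarrow> \<exists>a\<in>A. nrm (a - u) < e"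
      "\<And>l. l \<in> cspan G \<Longrightarrow> ip l u = 0"
  proof (rule minimal_distance[of A "cspan G"])
    show "A \<subseteq> S" using GS x by (auto simp: A_def)
    show "A \<noteq> {}" using complex_vector.span_zero by (auto simp: A_def)
  qed (use GS mid shift in \<open>auto intro: complex_vector.span_scale\<close>)
  have "u = 0"
  proof (rule assms(2)[OF u(1)])
    fix g assume "g \<in> G"
    then show "ip u g = 0"
      using u(3)[of g] ip_commute[of u g] u(1) G complex_vector.span_base by force
  qed
  then show ?thesis using u(2)[OF e] by (auto simp: A_def)
qed

end

section \<open>Operators on a Hilbert space\<close>

context hilbert
begin

text \<open>Banach-Steinhaus by Baire's theorem, phrased for seminorms so that the maps taking f to
  the norm of f(z), whose underlying values lie in another space, fit directly.\<close>

lemma uniform_boundedness: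
  assumes add: "\<And>i x y. \<lbrakk>i \<in> I; x \<in> S; y \<in> S\<rbrakk> \<Longrightarrow> p i (x + y) \<le> p i x + p i y"
    and scale: "\<And>i c x. \<lbrakk>i \<in> I; x \<in> S\<rbrakk> \<Longrightarrow> p i (c *\<^sub>C x) = cmod c * p i x"
    and bound: "\<And>i. i \<in> I \<Longrightarrow> \<exists>C. \<forall>x\<in>S. p i x \<le> C * nrm x"
    and pointwise: "\<And>x. x \<in> S \<Longrightarrow> \<exists>B. \<forall>i\<in>I. p i x \<le> B"
  shows "\<exists>C\<ge>0. \<forall>i\<in>I. \<forall>x\<in>S. p i x \<le> C * nrm x"
proof -
  have diff: "p i (x - y) \<le> p i x + p i y" if "i \<in> I" "x \<in> S" "y \<in> S" for i x y
    using add[of i x "(-1) *\<^sub>C y"] scale[of i y "-1"] scale_mem[of y "-1"] that by simp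
  define F where "F m = {x \<in> S. \<forall>i\<in>I. p i x \<le> real m}" for m :: nat
  have closed: "closedin mtopology (F m)" for m
    unfolding closedin_def topspace_mtopology openin_iff_nrm
  proof (intro conjI ballI)
    fix x assume x: "x \<in> S - F m"
    then obtain i where i: "i \<in> I" "p i x > real m" by (auto simp: F_def not_le)
    then obtain C where C: "\<And>y. y \<in> S \<Longrightarrow> p i y \<le> C * nrm y" using bound by blast
    \<comment> \<open>Within this distance \<open>p i\<close> cannot drop from \<open>p i x\<close>
      to the level \<open>m\<close>.\<close>
    define e where "e = (p i x - real m) / (\<bar>C\<bar> + 1)"
    have "e > 0" using i by (simp add: e_def add_nonneg_pos)
    moreover have "y \<notin> F m" if y: "y \<in> S" "nrm (y - x) < e" for y
    proof -
      have "p i (x - y) \<le> C * nrm (y - x)"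
        using C[of "x - y"] x y by (simp add: nrm_diff_commute)
      also have "\<dots> \<le> (\<bar>C\<bar> + 1) * nrm (y - x)"
        using x y by (intro mult_right_mono) auto
      also have "\<dots> < (\<bar>C\<bar> + 1) * e"
        using y by (intro mult_strict_left_mono) auto
      also have "\<dots> = p i x - real m" by (simp add: e_def)
      finally have "p i (x - y) < p i x - real m" .
      then have "p i y > real m" using add[of i "x - y" y] x y i by simp
      then show ?thesis using i by (force simp: F_def)
    qed
    ultimately show "\<exists>e>0. \<forall>y\<in>S. nrm (y - x) < e \<longrightarrow> y \<in> S - F m" by blast
  qed (auto simp: F_def)
  have un: "\<Union>(range F) = S"
  proof -
    have "\<exists>m. x \<in> F m" if x: "x \<in> S" for x
    proof -
      obtain B where B: "\<forall>i\<in>I. p i x \<le> B" using pointwise[OF x] by blast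
      obtain m :: nat where "B \<le> real m" using real_arch_simple by blast
      with B x have "x \<in> F m" unfolding F_def by fastforce
      then show ?thesis ..
    qed
    then show ?thesis by (auto simp: F_def)
  qed
  have "\<exists>m. mtopology interior_of F m \<noteq> {}"
  proof (rule ccontr)
    assume "\<not> ?thesis"
    then have "mtopology interior_of \<Union>(range F) = {}"
      using closed by (intro metric_Baire_category_alt[OF mcomplete]) auto
    then show False
      unfolding un using interior_of_topspace[of mtopology] zero_mem by simp
  qed
  then obtain m x0 where "x0 \<in> mtopology interior_of F m" by blast
  then obtain e where x0: "x0 \<in> S" and e: "e > 0" "\<And>y. \<lbrakk>y \<in> S; nrm (y - x0) < e\<rbrakk> \<Longrightarrow> y \<in> F m"
    using openin_interior_of[of mtopology "F m"] interior_of_subset[of mtopology "F m"]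
    unfolding openin_iff_nrm by (meson subsetD)
  have "p i x \<le> 4 * real m / e * nrm x" if i: "i \<in> I" and x: "x \<in> S" for i x
  proof (cases "x = 0")
    case True
    then show ?thesis using scale[OF i x, of 0] by simp
  next
    case False
    then have nx: "nrm x > 0" using nrm_eq_0[OF x] nrm_nonneg[OF x] by linarith
    \<comment> \<open>Scales x to norm e / 2, which keeps \<open>x0 + t x\<close> inside the ball
      contained in \<open>F m\<close>. Then \<open>t x\<close> is a difference of two members of
      \<open>F m\<close>, so \<open>p i\<close> is at most 2m on it.\<close>
    define t where "t = e / 2 / nrm x"
    have t: "t > 0" using e nx by (simp add: t_def)
    have "nrm (of_real t *\<^sub>C x) = e / 2"
      using x t nx by (simp add: nrm_scale) (simp add: t_def)
    then have y: "x0 + of_real t *\<^sub>C x \<in> F m"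
      using e(1) x x0 by (intro e(2)) simp_all
    have "t * p i x = p i ((x0 + of_real t *\<^sub>C x) - x0)"
      using t i x by (simp add: scale)
    also have "\<dots> \<le> p i (x0 + of_real t *\<^sub>C x) + p i x0"
      using i x x0 by (intro diff) auto
    also have "\<dots> \<le> real m + real m"
      using y e(2)[OF x0] e(1) i by (intro add_mono) (auto simp: F_def)
    finally have "p i x \<le> 2 * real m / t"
      using t by (simp add: field_simps)
    also have "\<dots> = 4 * real m / e * nrm x" by (simp add: t_def)
    finally show ?thesis .
  qed
  moreover have "4 * real m / e \<ge> 0" using e by simp
  ultimately show ?thesis by blast
qed

section \<open>Adjoints and continuity of a bounded operator\<close>

context
  fixes T
  assumes T: "bounded_operator_on S ip T"
begin

text \<open>\<open>adjoint_on\<close> is a definite description: existence is Riesz for the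
  functional x to \<open>ip (T x) y\<close>, and uniqueness holds because \<open>ip\<close>
  separates vectors.\<close>

lemma adjoint_on_exists:
  assumes y: "y \<in> S"
  shows "adjoint_on S ip T y \<in> S \<and> (\<forall>x\<in>S. ip (T x) y = ip x (adjoint_on S ip T y))"
proof -
  obtain C where C: "\<And>x. x \<in> S \<Longrightarrow> nrm (T x) \<le> C * nrm x"
    and T': "\<And>x. x \<in> S \<Longrightarrow> T x \<in> S" "\<And>x y. \<lbrakk>x \<in> S; y \<in> S\<rbrakk> \<Longrightarrow> T (x + y) = T x + T y"
      "\<And>c x. x \<in> S \<Longrightarrow> T (c *\<^sub>C x) = c *\<^sub>C T x"
    using T unfolding bounded_operator_on_def by blast
  have "cmod (ip (T x) y) \<le> (C * nrm y) * nrm x" if x: "x \<in> S" for x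
  proof -
    have "cmod (ip (T x) y) \<le> nrm (T x) * nrm y"
      using x y T' by (intro Cauchy_Schwarz) auto
    also have "\<dots> \<le> C * nrm x * nrm y"
      using x y C by (intro mult_right_mono) auto
    finally show ?thesis by (simp add: mult_ac)
  qed
  then have "\<exists>y'\<in>S. \<forall>x\<in>S. ip (T x) y = ip x y'"
    using y T' by (intro Riesz) (auto simp: ip_add_left ip_scale_left)
  moreover have "y' = y''" if "y' \<in> S \<and> (\<forall>x\<in>S. ip (T x) y = ip x y')"
      "y'' \<in> S \<and> (\<forall>x\<in>S. ip (T x) y = ip x y'')" for y' y''
    using that by (intro ip_eqI) auto
  ultimately have "\<exists>!y'. y' \<in> S \<and> (\<forall>x\<in>S. ip (T x) y = ip x y')" by blast
  then show ?thesis unfolding adjoint_on_def by (rule theI')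
qed

lemma adjoint_on_mem: "y \<in> S \<Longrightarrow> adjoint_on S ip T y \<in> S"
  using adjoint_on_exists by blast

lemma ip_adjoint_on: "\<lbrakk>x \<in> S; y \<in> S\<rbrakk> \<Longrightarrow> ip x (adjoint_on S ip T y) = ip (T x) y"
  using adjoint_on_exists by simp

lemma operator_mem: "x \<in> S \<Longrightarrow> T x \<in> S"
  using T unfolding bounded_operator_on_def by blast

lemma bounded_operator_on_adjoint: "bounded_operator_on S ip (adjoint_on S ip T)"
proof -
  obtain C where C: "\<And>x. x \<in> S \<Longrightarrow> nrm (T x) \<le> C * nrm x"
    using T unfolding bounded_operator_on_def by blast
  let ?A = "adjoint_on S ip T"
  have "nrm (?A y) \<le> C * nrm y" if y: "y \<in> S" for y
  proof (cases "nrm (?A y) = 0")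
    case True
    \<comment> \<open>The sign of \<open>C\<close> is unknown, but the bound at \<open>y\<close>
      itself makes this product nonnegative.\<close>
    have "0 \<le> C * nrm y" using nrm_nonneg[OF operator_mem[OF y]] C[OF y] by linarith
    then show ?thesis using True by simp
  next
    case False
    have Ay: "?A y \<in> S" using y by (rule adjoint_on_mem)
    have "(nrm (?A y))\<^sup>2 = cmod (ip (?A y) (?A y))"
      using Ay by (simp add: ip_self norm_power)
    also have "\<dots> = cmod (ip (T (?A y)) y)" using y Ay by (simp add: ip_adjoint_on)
    also have "\<dots> \<le> nrm (T (?A y)) * nrm y"
      using y Ay operator_mem by (intro Cauchy_Schwarz) auto
    also have "\<dots> \<le> C * nrm (?A y) * nrm y"
      using y Ay C by (intro mult_right_mono) auto
    finally have "nrm (?A y) * nrm (?A y) \<le> nrm (?A y) * (C * nrm y)"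
      by (simp add: power2_eq_square algebra_simps)
    moreover have "nrm (?A y) > 0" using False nrm_nonneg[OF Ay] by linarith
    ultimately show ?thesis by (simp only: mult_le_cancel_left_pos)
  qed
  moreover have "?A (x + y) = ?A x + ?A y" if "x \<in> S" "y \<in> S" for x y
    using that by (intro ip_eqI) (auto simp: adjoint_on_mem ip_adjoint_on ip_add_right operator_mem)
  moreover have "?A (c *\<^sub>C x) = c *\<^sub>C ?A x" if "x \<in> S" for c x
    using that by (intro ip_eqI) (auto simp: adjoint_on_mem ip_adjoint_on ip_scale_right operator_mem)
  ultimately show ?thesis
    unfolding bounded_operator_on_def using adjoint_on_mem by blast
qed

lemma continuous_map_operator: "continuous_map mtopology mtopology T"
proof -
  obtain C where C: "\<And>x. x \<in> S \<Longrightarrow> nrm (T x) \<le> C * nrm x"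
    and add: "\<And>x y. \<lbrakk>x \<in> S; y \<in> S\<rbrakk> \<Longrightarrow> T (x + y) = T x + T y"
    using T unfolding bounded_operator_on_def by blast
  have "\<exists>\<delta>>0. \<forall>x. x \<in> S \<and> ip_dist S ip a x < \<delta> \<longrightarrow> ip_dist S ip (T a) (T x) < e"
    if a: "a \<in> S" and e: "e > 0" for a e
  proof (intro exI conjI allI impI)
    show "e / (\<bar>C\<bar> + 1) > 0" using e by (simp add: add_nonneg_pos)
    fix x assume x: "x \<in> S \<and> ip_dist S ip a x < e / (\<bar>C\<bar> + 1)"
    have "nrm (T a - T x) = nrm (T (a - x))"
      using add[of "a - x" x] a x by (simp add: eq_diff_eq[symmetric])
    also have "\<dots> \<le> C * nrm (a - x)" using C a x by simp
    also have "\<dots> \<le> (\<bar>C\<bar> + 1) * nrm (a - x)"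
      using a x by (intro mult_right_mono) auto
    also have "\<dots> < e"
      using a x dist_eq[of a x] by (simp add: pos_less_divide_eq add_nonneg_pos mult.commute)
    finally show "ip_dist S ip (T a) (T x) < e"
      using a x by (simp add: dist_eq operator_mem)
  qed
  then show ?thesis
    unfolding metric_continuous_map[OF Metric_space_axioms] using operator_mem by blast
qed

end

text \<open>Finite combinations of \<open>G\<close> with coefficients from a countable dense set of
  scalars are dense in the span, which is dense by orthogonality. Lists of coefficient-vector pairs
  make their countability immediate.\<close>

lemma separable_if_countable_total:
  assumes G: "G \<subseteq> S" "countable G"
    and total: "\<And>x. \<lbrakk>x \<in> S; \<And>g. g \<in> G \<Longrightarrow> ip x g = 0\<rbrakk> \<Longrightarrow> x = 0"
  shows "separable_space mtopology"
proof -
  obtain Q :: "complex set" where Q: "countable Q" "\<And>X. \<lbrakk>open X; X \<noteq> {}\<rbrakk> \<Longrightarrow> \<exists>q\<in>Q. q \<in> X"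
    using countable_dense_exists by metis
  define f where "f l = sum_list (map (\<lambda>(q, g). q *\<^sub>C g) l)" for l :: "(complex \<times> 'a) list"
  define D where "D = f ` lists (Q \<times> G)"
  have fS: "f l \<in> S" if "l \<in> lists (Q \<times> G)" for l
    using that by (induction l) (use G in \<open>auto simp: f_def\<close>)
  have near: "x \<in> S \<and> (\<forall>e>0. \<exists>y\<in>D. nrm (x - y) < e)" if "x \<in> cspan G" for x
    using that
  proof (induction rule: complex_vector.span_induct_alt)
    case base
    have "f [] \<in> D" by (auto simp: D_def)
    then show ?case by (auto simp: f_def intro!: bexI[of _ 0])
  next
    case (step c g y)
    have gS: "g \<in> S" and yS: "y \<in> S" using step G by blast+
    show ?case
    proof (intro conjI allI impI)
      show "c *\<^sub>C g + y \<in> S" using gS yS by simp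
      fix e :: real assume e: "e > 0"
      have "e / 2 > 0" using e by simp
      then obtain l where l: "l \<in> lists (Q \<times> G)" "nrm (y - f l) < e / 2"
        using step unfolding D_def by blast
      \<comment> \<open>The added 1 covers the case that \<open>g\<close> is 0.\<close>
      have pos: "nrm g + 1 > 0" using gS by (simp add: add_nonneg_pos)
      then have "e / 2 / (nrm g + 1) > 0" using e by (intro divide_pos_pos) auto
      then have "ball c (e / 2 / (nrm g + 1)) \<noteq> {}" by simp
      then obtain q where q: "q \<in> Q" "cmod (c - q) < e / 2 / (nrm g + 1)"
        using Q(2)[OF open_ball] by (auto simp: dist_norm)
      have "nrm ((c *\<^sub>C g + y) - f ((q, g) # l)) = nrm ((c - q) *\<^sub>C g + (y - f l))"
        by (simp add: f_def complex_vector.scale_left_diff_distrib algebra_simps)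
      also have "\<dots> \<le> cmod (c - q) * nrm g + nrm (y - f l)"
        using gS yS fS[OF l(1)] nrm_triangle[of "(c - q) *\<^sub>C g" "y - f l"] by (simp add: nrm_scale)
      also have "cmod (c - q) * nrm g \<le> cmod (c - q) * (nrm g + 1)"
        by (intro mult_left_mono) auto
      also have "\<dots> < e / 2"
        using q(2) unfolding pos_less_divide_eq[OF pos] .
      finally have "nrm ((c *\<^sub>C g + y) - f ((q, g) # l)) < e" using l by simp
      moreover have "f ((q, g) # l) \<in> D" using l q step by (auto simp: D_def)
      ultimately show "\<exists>z\<in>D. nrm ((c *\<^sub>C g + y) - z) < e" by blast
    qed
  qed
  have "\<exists>z\<in>D. nrm (x - z) < e" if x: "x \<in> S" and e: "e > 0" for x e
  proof -
    obtain y where y: "y \<in> cspan G" "nrm (x - y) < e / 2"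
      using span_dense[OF G(1) total x, of "e / 2"] e by auto
    then obtain z where z: "z \<in> D" "nrm (y - z) < e / 2" using near e by (meson half_gt_zero)
    have "y \<in> S" "z \<in> S" using y z span_mem[OF G(1)] fS by (auto simp: D_def)
    then have "nrm (x - z) < e" using nrm_triangle_diff[OF x, of y z] y z by linarith
    then show ?thesis using z by blast
  qed
  moreover have DS: "D \<subseteq> S" using fS by (auto simp: D_def)
  ultimately have "mtopology closure_of D = S"
    using closure_of_iff_nrm[OF DS] by blast
  moreover have "countable D"
    unfolding D_def using Q(1) G(2) by (intro countable_image countable_lists countable_SIGMA) auto
  ultimately show ?thesis
    unfolding separable_space_def using DS by auto
qed

end

section \<open>Hypercyclicity and mixing\<close>

lemma (in Metric_space) hypercyclic_on_if_transitive:
  assumes "mcomplete" "separable_space mtopology" "M \<noteq> {}"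
    and cont: "continuous_map mtopology mtopology T"
    and trans: "\<And>U V. \<lbrakk>openin mtopology U; openin mtopology V; U \<noteq> {}; V \<noteq> {}\<rbrakk> \<Longrightarrow>
      \<exists>j. \<exists>x\<in>V. (T ^^ j) x \<in> U"
  shows "hypercyclic_on mtopology T"
proof -
  obtain D where D: "countable D" "D \<subseteq> M" "mtopology closure_of D = M"
    using assms(2) unfolding separable_space_def by auto
  have contj: "continuous_map mtopology mtopology (T ^^ j)" for j
  proof (induction j)
    case (Suc j)
    show ?case unfolding funpow.simps using continuous_map_compose[OF Suc cont] .
  qed (simp add: id_def)
  \<comment> \<open>The points whose orbit meets a given small ball about a given centre. These sets
    are open by continuity and dense by transitivity, and a point common to all of them has a dense
    orbit.\<close>
  define G where "G dn = {x \<in> M. \<exists>j. (T ^^ j) x \<in> mball (fst dn) (1 / real (Suc (snd dn)))}" for dn :: "'a \<times> nat"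
  have op: "openin mtopology (G dn)" for dn
  proof -
    have "G dn = (\<Union>j. {x \<in> topspace mtopology. (T ^^ j) x \<in> mball (fst dn) (1 / real (Suc (snd dn)))})"
      by (auto simp: G_def)
    then show ?thesis
      using openin_continuous_map_preimage[OF contj openin_mball] by auto
  qed
  have dense: "mtopology closure_of (G dn) = M" if "fst dn \<in> M" for dn
  proof -
    have "\<exists>y. y \<in> G dn \<and> y \<in> V" if x: "x \<in> V" and V: "openin mtopology V" for x V
    proof -
      have "mball (fst dn) (1 / real (Suc (snd dn))) \<noteq> {}"
        using \<open>fst dn \<in> M\<close> by (simp add: mball_eq_empty)
      then obtain j y where "y \<in> V" "(T ^^ j) y \<in> mball (fst dn) (1 / real (Suc (snd dn)))"
        using trans[OF openin_mball, of V "fst dn" "1 / real (Suc (snd dn))"] x V by blast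
      then show ?thesis using openin_subset[OF V] by (auto simp: G_def)
    qed
    then show ?thesis by (auto simp: in_closure_of)
  qed
  have "mtopology closure_of \<Inter>(G ` (D \<times> UNIV)) = M"
    using D op dense by (intro metric_Baire_category[OF assms(1)]) auto
  then have "\<Inter>(G ` (D \<times> UNIV)) \<noteq> {}" using assms(3) by force
  then obtain x where x: "\<And>d n. d \<in> D \<Longrightarrow> x \<in> G (d, n)" by auto
  have "D \<noteq> {}" using D(3) assms(3) by force
  then have xM: "x \<in> M" using x by (auto simp: G_def)
  have "\<exists>z\<in>{(T ^^ n) x |n. True}. z \<in> mball y r" if y: "y \<in> M" and r: "r > 0" for y r
  proof -
    \<comment> \<open>Half of \<open>r\<close> is for the distance from \<open>y\<close> to the
      centre \<open>d\<close>, half for the distance from \<open>d\<close> to the orbit.\<close>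
    obtain n where n: "1 / real (Suc n) < r / 2" using nat_approx_posE[of "r / 2"] r by auto
    have "r / 2 > 0" using r by simp
    then obtain d where d: "d \<in> D" "d \<in> mball y (r / 2)"
      using y D(3) unfolding metric_closure_of by blast
    obtain j where j: "(T ^^ j) x \<in> mball d (1 / real (Suc n))"
      using x[OF d(1), of n] by (auto simp: G_def)
    then have "(T ^^ j) x \<in> mball y r"
      using n d triangle[of y d "(T ^^ j) x"] by auto
    then show ?thesis by blast
  qed
  then have "mtopology closure_of {(T ^^ n) x |n. True} = M"
    unfolding metric_closure_of by blast
  then show ?thesis
    unfolding hypercyclic_on_def using xM by auto
qed

context hilbert
begin

text \<open>The right inverse of \<open>T\<close> in Kitai's criterion need not be a well-defined map on the span of
  the \<open>k n i\<close>, which may be linearly dependent, so preimages are chosen for each vector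
  separately. Vanishing of \<open>k n i\<close> along the subsequence \<open>r\<close> is passed down to a fixed shift
  \<open>r m - s\<close> by applying \<open>T\<close> a further \<open>s\<close> times.\<close>

lemma backward_shift_transitive:
  fixes k :: "nat \<Rightarrow> 'i \<Rightarrow> 'a" and r :: "nat \<Rightarrow> nat"
  assumes T: "bounded_operator_on S ip T"
    and kS: "\<And>n i. i \<in> I \<Longrightarrow> k n i \<in> S"
    and shift: "\<And>n i. i \<in> I \<Longrightarrow> T (k (Suc n) i) = k n i" "\<And>i. i \<in> I \<Longrightarrow> T (k 0 i) = 0"
    and total: "\<And>x. \<lbrakk>x \<in> S; \<And>n i. i \<in> I \<Longrightarrow> ip x (k n i) = 0\<rbrakk> \<Longrightarrow> x = 0"
    and r: "strict_mono r" and lim: "\<And>i. i \<in> I \<Longrightarrow> (\<lambda>m. nrm (k (r m) i)) \<longlonglongrightarrow> 0"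
    and U: "openin mtopology U" "U \<noteq> {}" and V: "openin mtopology V" "V \<noteq> {}"
  shows "\<exists>s N. \<forall>m\<ge>N. s \<le> r m \<and> (\<exists>x\<in>V. (T ^^ (r m - s)) x \<in> U)"
proof -
  obtain C where C: "\<And>x. x \<in> S \<Longrightarrow> nrm (T x) \<le> C * nrm x"
    and TS: "\<And>x. x \<in> S \<Longrightarrow> T x \<in> S"
    and Tadd: "\<And>x y. \<lbrakk>x \<in> S; y \<in> S\<rbrakk> \<Longrightarrow> T (x + y) = T x + T y"
    and Tscale: "\<And>c x. x \<in> S \<Longrightarrow> T (c *\<^sub>C x) = c *\<^sub>C T x"
    using T unfolding bounded_operator_on_def by blast
  have TjS: "(T ^^ j) x \<in> S" if "x \<in> S" for j x
    using that by (induction j) (auto simp: TS)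
  have Tjadd: "(T ^^ j) (x + y) = (T ^^ j) x + (T ^^ j) y" if "x \<in> S" "y \<in> S" for j x y
    using that by (induction j) (auto simp: TjS Tadd)
  have Tjscale: "(T ^^ j) (c *\<^sub>C x) = c *\<^sub>C (T ^^ j) x" if "x \<in> S" for j c x
    using that by (induction j) (auto simp: TjS Tscale)
  have Tjnrm: "nrm ((T ^^ j) x) \<le> \<bar>C\<bar> ^ j * nrm x" if x: "x \<in> S" for j x
  proof (induction j)
    case (Suc j)
    have "nrm ((T ^^ Suc j) x) \<le> C * nrm ((T ^^ j) x)" using C TjS x by simp
    also have "\<dots> \<le> \<bar>C\<bar> * nrm ((T ^^ j) x)" using TjS x by (intro mult_right_mono) auto
    also have "\<dots> \<le> \<bar>C\<bar> * (\<bar>C\<bar> ^ j * nrm x)" using Suc by (intro mult_left_mono) auto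
    finally show ?case by (simp add: mult.assoc)
  qed simp
  have Tj0: "(T ^^ j) 0 = 0" for j
    using Tjscale[of 0 j 0] by simp
  have Tjk: "(T ^^ j) (k (j + n) i) = k n i" if "i \<in> I" for j n i
    using that by (induction j arbitrary: n) (simp_all add: shift funpow_Suc_right del: funpow.simps)
  have Tjk0: "(T ^^ j) (k n i) = 0" if i: "i \<in> I" and "j > n" for j n i
  proof -
    obtain q where q: "j = q + Suc n" using \<open>j > n\<close> less_imp_Suc_add[of n j] by auto
    have "(T ^^ Suc n) (k n i) = 0" using Tjk[OF i, of n 0] shift(2)[OF i] by simp
    then show ?thesis unfolding q funpow_add by (simp add: Tj0 del: funpow.simps)
  qed
  define G where "G = {k n i | n i. i \<in> I}"
  have GS: "G \<subseteq> S" using kS by (auto simp: G_def)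
  have spanS: "cspan G \<subseteq> S" using span_mem[OF GS] .
  have forward: "x \<in> S \<and> (\<exists>N. \<forall>j\<ge>N. (T ^^ j) x = 0)" if "x \<in> cspan G" for x
    using that
  proof (induction rule: complex_vector.span_induct_alt)
    case (step c g y)
    obtain n i where g: "g = k n i" "i \<in> I" using step by (auto simp: G_def)
    obtain N where N: "\<forall>j\<ge>N. (T ^^ j) y = 0" using step by blast
    have "(T ^^ j) (c *\<^sub>C g + y) = 0" if "j \<ge> max N (Suc n)" for j
      using that N g kS step Tjk0[of i n j] by (auto simp: Tjadd Tjscale)
    moreover have "c *\<^sub>C g + y \<in> S" using step GS by auto
    ultimately show ?case by blast
  qed (simp add: Tj0)
  \<comment> \<open>The claim is made for all large \<open>s\<close>, not just one, so that in the
    induction over the span the two summands can be given the same shift.\<close>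
  have backward: "\<exists>N. \<forall>s\<ge>N. \<exists>u. (\<forall>m. u m \<in> S \<and> (s \<le> r m \<longrightarrow> (T ^^ (r m - s)) (u m) = x))
      \<and> (\<lambda>m. nrm (u m)) \<longlonglongrightarrow> 0" if "x \<in> cspan G" for x
    using that
  proof (induction rule: complex_vector.span_induct_alt)
    case base
    show ?case by (intro exI[of _ 0] allI impI exI[of _ "\<lambda>_. 0"]) (simp add: Tj0)
  next
    case (step c g y)
    obtain n i where g: "g = k n i" "i \<in> I" using step by (auto simp: G_def)
    obtain N where N: "\<And>s. s \<ge> N \<Longrightarrow> \<exists>u. (\<forall>m. u m \<in> S \<and> (s \<le> r m \<longrightarrow> (T ^^ (r m - s)) (u m) = y))
      \<and> (\<lambda>m. nrm (u m)) \<longlonglongrightarrow> 0" using step by blast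
    show ?case
    proof (intro exI[of _ "max N n"] allI impI)
      fix s assume s: "max N n \<le> s"
      then obtain u where u: "\<And>m. u m \<in> S" "\<And>m. s \<le> r m \<Longrightarrow> (T ^^ (r m - s)) (u m) = y"
          "(\<lambda>m. nrm (u m)) \<longlonglongrightarrow> 0"
        using N[of s] by (metis max.bounded_iff)
      \<comment> \<open>This is k at index r m - s + n once \<open>s \<le> r m\<close>, so
        \<open>T ^^ (r m - s)\<close> takes it to \<open>k n i\<close>. Writing it as a fixed power
        of \<open>T\<close> applied to \<open>k (r m) i\<close> makes it tend to 0.\<close>
      define w where "w m = (T ^^ (s - n)) (k (r m) i)" for m
      have wS: "w m \<in> S" for m using g kS TjS by (simp add: w_def)
      have w: "(T ^^ (r m - s)) (w m) = g" if "s \<le> r m" for m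
      proof -
        have "(T ^^ (r m - s)) (w m) = (T ^^ (r m - n)) (k (r m - n + n) i)"
          using that s funpow_add[of "r m - s" "s - n" T] by (simp add: w_def)
        then show ?thesis using Tjk g by simp
      qed
      have w0: "(\<lambda>m. nrm (w m)) \<longlonglongrightarrow> 0"
      proof (rule tendsto_sandwich[where f = "\<lambda>_. 0"])
        show "(\<lambda>m. \<bar>C\<bar> ^ (s - n) * nrm (k (r m) i)) \<longlonglongrightarrow> 0"
          using tendsto_mult_right_zero[OF lim[OF g(2)]] by simp
        show "\<forall>\<^sub>F m in sequentially. nrm (w m) \<le> \<bar>C\<bar> ^ (s - n) * nrm (k (r m) i)"
          unfolding w_def using Tjnrm kS g by simp
      qed (use wS in auto)
      have "(\<lambda>m. nrm (c *\<^sub>C w m + u m)) \<longlonglongrightarrow> 0"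
      proof (rule tendsto_sandwich[where f = "\<lambda>_. 0"])
        show "(\<lambda>m. cmod c * nrm (w m) + nrm (u m)) \<longlonglongrightarrow> 0"
          using tendsto_add[OF tendsto_mult_right_zero[OF w0] u(3)] by simp
        show "\<forall>\<^sub>F m in sequentially. nrm (c *\<^sub>C w m + u m) \<le> cmod c * nrm (w m) + nrm (u m)"
          using nrm_triangle[of "c *\<^sub>C w m" "u m" for m] wS u by (simp add: nrm_scale)
      qed (use wS u in auto)
      moreover have "(T ^^ (r m - s)) (c *\<^sub>C w m + u m) = c *\<^sub>C g + y" if "s \<le> r m" for m
        using that wS u w by (simp add: Tjadd Tjscale)
      ultimately show "\<exists>u. (\<forall>m. u m \<in> S \<and> (s \<le> r m \<longrightarrow> (T ^^ (r m - s)) (u m) = c *\<^sub>C g + y))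
          \<and> (\<lambda>m. nrm (u m)) \<longlonglongrightarrow> 0"
        using wS u by (intro exI[of _ "\<lambda>m. c *\<^sub>C w m + u m"]) auto
    qed
  qed
  have total': "x = 0" if "x \<in> S" "\<And>g. g \<in> G \<Longrightarrow> ip x g = 0" for x
    using that by (intro total) (auto simp: G_def)
  have pick: "\<exists>x\<in>cspan G. x \<in> W" if W: "openin mtopology W" "W \<noteq> {}" for W
  proof -
    obtain a where a: "a \<in> W" using W by blast
    then obtain e where e: "e > 0" "\<And>y. \<lbrakk>y \<in> S; nrm (y - a) < e\<rbrakk> \<Longrightarrow> y \<in> W" and aS: "a \<in> S"
      using W(1) unfolding openin_iff_nrm by (meson subsetD)
    obtain y where y: "y \<in> cspan G" "nrm (a - y) < e"
      using span_dense[OF GS total' aS e(1)] by blast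
    then show ?thesis using e(2)[of y] spanS aS by (auto simp: nrm_diff_commute)
  qed
  obtain x where x: "x \<in> cspan G" "x \<in> V" using pick[OF V] by blast
  obtain y where y: "y \<in> cspan G" "y \<in> U" using pick[OF U] by blast
  obtain N0 where N0: "\<And>j. j \<ge> N0 \<Longrightarrow> (T ^^ j) x = 0" using forward[OF x(1)] by blast
  obtain s u where uS: "\<And>m. u m \<in> S" and uT: "\<And>m. s \<le> r m \<Longrightarrow> (T ^^ (r m - s)) (u m) = y"
    and u0: "(\<lambda>m. nrm (u m)) \<longlonglongrightarrow> 0"
    using backward[OF y(1)] by (metis order_refl)
  obtain e where e: "e > 0" "\<And>z. \<lbrakk>z \<in> S; nrm (z - x) < e\<rbrakk> \<Longrightarrow> z \<in> V"
    using V(1) x(2) unfolding openin_iff_nrm by blast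
  obtain N1 where N1: "\<And>m. m \<ge> N1 \<Longrightarrow> nrm (u m) < e"
    using order_tendstoD(2)[OF u0 e(1)] by (auto simp: eventually_sequentially)
  \<comment> \<open>The witness is \<open>x + u m\<close>: it lies near \<open>x\<close>, and the
    power of \<open>T\<close> kills \<open>x\<close> and takes \<open>u m\<close> to
    \<open>y\<close>. Since \<open>m \<le> r m\<close>, the bound \<open>N0 + s\<close> makes the
    exponent at least \<open>N0\<close>.\<close>
  have "s \<le> r m \<and> (\<exists>x\<in>V. (T ^^ (r m - s)) x \<in> U)" if m: "m \<ge> max N1 (N0 + s)" for m
  proof
    have rm: "m \<le> r m" using r by (rule strict_mono_imp_increasing)
    then show s: "s \<le> r m" using m by simp
    have xS: "x \<in> S" using x spanS by blast
    have "x + u m \<in> V" using e(2)[of "x + u m"] N1[of m] m xS uS by simp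
    moreover have "N0 \<le> r m - s" using m rm by linarith
    then have "(T ^^ (r m - s)) (x + u m) = y"
      using xS uS N0 uT[OF s] by (simp add: Tjadd)
    ultimately show "\<exists>x\<in>V. (T ^^ (r m - s)) x \<in> U" using y by auto
  qed
  then show ?thesis by blast
qed

end

section \<open>Vector-valued analytic functions\<close>

lemma bounded_linear_scaleC_left: "bounded_linear (\<lambda>h. h *\<^sub>C (D::'a::complex_normed_vector))"
  by (rule bounded_linear_intro[where K = "norm D"])
    (simp_all add: scaleC_add_left scaleR_scaleC scaleC_scaleC norm_scaleC scaleC_complex_def)

lemma deriv_z_eqI:
  assumes "(f has_derivative (\<lambda>h. h *\<^sub>C D)) (at z)"
  shows "deriv_z f z = D"
  unfolding deriv_z_def
proof (rule the_equality, rule assms)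
  fix D' assume "(f has_derivative (\<lambda>h. h *\<^sub>C D')) (at z)"
  from has_derivative_unique[OF this assms] show "D' = D"
    by (metis scaleC_one)
qed

lemma has_derivative_deriv_z:
  assumes "vector_analytic_on f S" "z \<in> S"
  shows "(f has_derivative (\<lambda>h. h *\<^sub>C deriv_z f z)) (at z)"
  using assms deriv_z_eqI unfolding vector_analytic_on_def by metis

text \<open>No differentiability is assumed: substituting the conjugate makes the two defining
  conditions on D equivalent, so the two descriptions agree in any case. Co-analytic derivatives
  thereby reduce to analytic ones.\<close>

lemma deriv_zbar_eq: "deriv_zbar f z = deriv_z (\<lambda>v. f (cnj v)) (cnj z)"
proof -
  have "((\<lambda>x. g (cnj x)) has_derivative (\<lambda>h. g' (cnj h))) (at (cnj z))"
    if "(g has_derivative g') (at z)" for g g' and z :: complex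
    using has_derivative_compose[OF bounded_linear_imp_has_derivative[OF bounded_linear_cnj, of "at (cnj z)"], of g g'] that
    by simp
  from this[of f "\<lambda>h. cnj h *\<^sub>C D" z for D]
    this[of "\<lambda>v. f (cnj v)" "\<lambda>h. h *\<^sub>C D" "cnj z" for D]
  have "(f has_derivative (\<lambda>h. cnj h *\<^sub>C D)) (at z) \<longleftrightarrow>
      ((\<lambda>v. f (cnj v)) has_derivative (\<lambda>h. h *\<^sub>C D)) (at (cnj z))" for D
    by auto
  then show ?thesis by (simp add: deriv_zbar_def deriv_z_def)
qed

lemma higher_deriv_zbar_eq: "(deriv_zbar ^^ n) f z = (deriv_z ^^ n) (\<lambda>v. f (cnj v)) (cnj z)"
proof (induction n arbitrary: z)
  case (Suc n)
  then show ?case by (simp add: deriv_zbar_eq)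
qed simp

lemma has_field_derivative_functional:
  fixes \<phi> :: "'b::complex_normed_vector \<Rightarrow> complex"
  assumes f: "vector_analytic_on f S" "z \<in> S"
    and \<phi>: "bounded_linear \<phi>" "\<And>c x. \<phi> (c *\<^sub>C x) = c * \<phi> x"
  shows "((\<lambda>z. \<phi> (f z)) has_field_derivative \<phi> (deriv_z f z)) (at z)"
  using bounded_linear.has_derivative[OF \<phi>(1) has_derivative_deriv_z[OF f]]
  by (simp add: has_field_derivative_def \<phi>(2) mult.commute[of _ "\<phi> (deriv_z f z)"])

lemma holomorphic_functional:
  fixes \<phi> :: "'b::complex_normed_vector \<Rightarrow> complex"
  assumes "vector_analytic_on f S" "open S" "bounded_linear \<phi>" "\<And>c x. \<phi> (c *\<^sub>C x) = c * \<phi> x"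
  shows "(\<lambda>z. \<phi> (f z)) holomorphic_on S"
  using has_field_derivative_functional[OF assms(1) _ assms(3,4)]
  by (auto simp: holomorphic_on_open[OF assms(2)])

lemma continuous_on_vector_analytic:
  assumes "vector_analytic_on f S"
  shows "continuous_on S f"
  by (intro continuous_at_imp_continuous_on ballI
      has_derivative_continuous[OF has_derivative_deriv_z[OF assms]])

text \<open>The constant depends on the bound \<open>B\<close> alone, hence serves a whole family of
  functions. It is Cauchy's estimate for the second derivative on discs of radius r about points of
  \<open>ball z r\<close>, all of which stay inside \<open>ball z (2 * r)\<close>, put into the
  Taylor remainder.\<close>

lemma holomorphic_difference_quotient_bound:
  assumes hol: "g holomorphic_on ball z (2 * r)" and r: "r > 0"
    and bd: "\<And>w. w \<in> ball z (2 * r) \<Longrightarrow> cmod (g w) \<le> B"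
    and h: "cmod h < r"
  shows "cmod (g (z + h) - g z - deriv g z * h) \<le> 2 * B / r\<^sup>2 * (cmod h)\<^sup>2"
proof -
  have B2: "cmod ((deriv ^^ 2) g w) \<le> 2 * B / r\<^sup>2" if w: "w \<in> ball z r" for w
  proof -
    have sub: "cball w r \<subseteq> ball z (2 * r)"
    proof
      fix y assume "y \<in> cball w r"
      then show "y \<in> ball z (2 * r)"
        using w dist_triangle[of z y w] by simp
    qed
    have "cmod ((deriv ^^ 2) g w) \<le> fact 2 * B / r ^ 2"
    proof (rule Cauchy_inequality[OF _ _ r])
      show "g holomorphic_on ball w r"
        using hol holomorphic_on_subset sub ball_subset_cball by blast
      show "continuous_on (cball w r) g"
        using hol holomorphic_on_imp_continuous_on continuous_on_subset sub by blast
      show "cmod (g x) \<le> B" if "cmod (w - x) = r" for x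
        using that sub by (intro bd) (auto simp: dist_norm)
    qed
    then show ?thesis by (simp add: fact_2)
  qed
  have "cmod ((deriv ^^ 0) g (z + h) - (\<Sum>i\<le>1. (deriv ^^ i) g z * (z + h - z) ^ i / fact i))
      \<le> 2 * B / r\<^sup>2 * cmod (z + h - z) ^ Suc 1 / fact 1"
  proof (rule complex_Taylor[where S = "ball z r"])
    fix i x assume x: "x \<in> ball z r"
    then have x2: "x \<in> ball z (2 * r)" using r by simp
    have "(deriv ^^ i) g holomorphic_on ball z (2 * r)"
      using hol by (intro holomorphic_higher_deriv) auto
    then show "((deriv ^^ i) g has_field_derivative (deriv ^^ Suc i) g x) (at x within ball z r)"
      using holomorphic_derivI[OF _ _ x2] by (simp add: has_field_derivative_at_within)
  next
    show "cmod ((deriv ^^ Suc 1) g x) \<le> 2 * B / r\<^sup>2" if "x \<in> ball z r" for x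
      using B2[OF that] by (simp add: numeral_2_eq_2)
  qed (use r h in \<open>auto simp: dist_norm\<close>)
  then show ?thesis by (simp add: algebra_simps numeral_2_eq_2)
qed

text \<open>A substitute for the unit ball of the dual space, large enough to recover the norm. The
  last condition is phrased through upper bounds \<open>c\<close>, so no supremum has to be
  handled.\<close>

locale norming =
  fixes \<Phi> :: "('b::{complex_normed_vector, banach} \<Rightarrow> complex) set"
  assumes \<Phi>_add: "\<And>\<phi> x y. \<phi> \<in> \<Phi> \<Longrightarrow> \<phi> (x + y) = \<phi> x + \<phi> y"
    and \<Phi>_scale: "\<And>\<phi> c x. \<phi> \<in> \<Phi> \<Longrightarrow> \<phi> (c *\<^sub>C x) = c * \<phi> x"
    and \<Phi>_bound: "\<And>\<phi> x. \<phi> \<in> \<Phi> \<Longrightarrow> cmod (\<phi> x) \<le> norm x"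
    and \<Phi>_norming: "\<And>x c. \<lbrakk>0 \<le> c; \<And>\<phi>. \<phi> \<in> \<Phi> \<Longrightarrow> cmod (\<phi> x) \<le> c\<rbrakk> \<Longrightarrow> norm x \<le> c"
begin

lemma \<Phi>_diff: "\<phi> \<in> \<Phi> \<Longrightarrow> \<phi> (x - y) = \<phi> x - \<phi> y"
  using \<Phi>_add[of \<phi> "x - y" y] by simp

lemma \<Phi>_bounded_linear:
  assumes "\<phi> \<in> \<Phi>" shows "bounded_linear \<phi>"
  using \<Phi>_bound[OF assms]
  by (intro bounded_linear_intro[where K = 1])
    (simp_all add: assms \<Phi>_add \<Phi>_scale scaleR_scaleC scaleC_complex_def)

text \<open>The second-order Taylor bound for the functions \<open>\<phi> \<circ> f\<close> is uniform in \<open>\<phi>\<close>, which makes the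
  difference quotients of \<open>f\<close> Cauchy in norm.\<close>

lemma vector_analytic_onI:
  assumes S: "open S"
    and hol: "\<And>\<phi>. \<phi> \<in> \<Phi> \<Longrightarrow> (\<lambda>z. \<phi> (f z)) holomorphic_on S"
    and bd: "\<And>z. z \<in> S \<Longrightarrow> \<exists>r>0. \<exists>B. \<forall>w\<in>S \<inter> ball z r. norm (f w) \<le> B"
  shows "vector_analytic_on f S"
  unfolding vector_analytic_on_def
proof
  fix z assume z: "z \<in> S"
  obtain r1 where r1: "r1 > 0" "ball z r1 \<subseteq> S" using S z open_contains_ball by blast
  obtain r2 B where r2: "r2 > 0" "\<And>w. w \<in> S \<inter> ball z r2 \<Longrightarrow> norm (f w) \<le> B"
    using bd[OF z] by blast
  define r where "r = min r1 r2 / 2"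
  have r: "r > 0" using r1 r2 by (simp add: r_def)
  have sub: "ball z (2 * r) \<subseteq> S" and B: "norm (f w) \<le> B" if "w \<in> ball z (2 * r)" for w
    using r1 r2 that by (auto simp: r_def)
  define C where "C = 2 * B / r\<^sup>2"
  have "0 \<le> B" using B[of z] norm_ge_zero[of "f z"] r by (smt (verit) centre_in_ball)
  then have C: "0 \<le> C" by (simp add: C_def)
  define q where "q h = inverse h *\<^sub>C (f (z + h) - f z)" for h
  have \<phi>q: "cmod (\<phi> (q h) - deriv (\<lambda>z. \<phi> (f z)) z) \<le> C * cmod h"
    if \<phi>: "\<phi> \<in> \<Phi>" and h: "cmod h < r" "h \<noteq> 0" for \<phi> h
  proof -
    let ?g = "\<lambda>z. \<phi> (f z)"
    have "cmod (?g (z + h) - ?g z - deriv ?g z * h) \<le> C * (cmod h)\<^sup>2"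
      unfolding C_def
    proof (rule holomorphic_difference_quotient_bound[OF _ r _ h(1)])
      show "?g holomorphic_on ball z (2 * r)"
        using hol[OF \<phi>] holomorphic_on_subset sub r by (metis centre_in_ball mult_pos_pos zero_less_numeral)
      show "cmod (?g w) \<le> B" if "w \<in> ball z (2 * r)" for w
        using \<Phi>_bound[OF \<phi>, of "f w"] B[OF that] by linarith
    qed
    moreover have "?g (z + h) - ?g z - deriv ?g z * h = (\<phi> (q h) - deriv ?g z) * h"
      using h by (simp add: q_def \<Phi>_scale[OF \<phi>] \<Phi>_diff[OF \<phi>] field_simps)
    ultimately have "cmod (\<phi> (q h) - deriv ?g z) * cmod h \<le> (C * cmod h) * cmod h"
      by (simp add: norm_mult power2_eq_square mult.assoc)
    then show ?thesis using h by simp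
  qed
  \<comment> \<open>Comparing two difference quotients cancels the scalar derivative, so no
    candidate for the vector derivative is needed yet.\<close>
  have qq: "norm (q h - q k) \<le> C * (cmod h + cmod k)"
    if "cmod h < r" "h \<noteq> 0" "cmod k < r" "k \<noteq> 0" for h k
  proof (rule \<Phi>_norming)
    show "0 \<le> C * (cmod h + cmod k)" using C by simp
    fix \<phi> assume \<phi>: "\<phi> \<in> \<Phi>"
    let ?d = "deriv (\<lambda>z. \<phi> (f z)) z"
    have "cmod (\<phi> (q h - q k)) = cmod ((\<phi> (q h) - ?d) - (\<phi> (q k) - ?d))"
      by (simp add: \<Phi>_diff[OF \<phi>])
    also have "\<dots> \<le> cmod (\<phi> (q h) - ?d) + cmod (\<phi> (q k) - ?d)" by (rule norm_triangle_ineq4)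
    also have "\<dots> \<le> C * (cmod h + cmod k)"
      using \<phi>q[OF \<phi>, of h] \<phi>q[OF \<phi>, of k] that by (simp add: distrib_left)
    finally show "cmod (\<phi> (q h - q k)) \<le> C * (cmod h + cmod k)" .
  qed
  \<comment> \<open>Any null sequence of nonzero increments of modulus below \<open>r\<close> would
    do; starting the denominators at 2 makes the bound strict.\<close>
  define t where "t n = complex_of_real (r / real (Suc (Suc n)))" for n
  have t: "cmod (t n) < r" "t n \<noteq> 0" for n
    unfolding t_def norm_of_real of_real_eq_0_iff using r by (simp_all add: divide_less_eq)
  have t0: "(\<lambda>n. cmod (t n)) \<longlonglongrightarrow> 0"
  proof -
    have "(\<lambda>n. r * inverse (real (Suc (Suc n)))) \<longlonglongrightarrow> r * 0"
      by (intro tendsto_mult tendsto_const LIMSEQ_Suc[OF LIMSEQ_inverse_real_of_nat])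
    moreover have "cmod (t n) = r * inverse (real (Suc (Suc n)))" for n
      using r unfolding t_def norm_of_real by (simp add: divide_inverse)
    ultimately show ?thesis by simp
  qed
  have "Cauchy (\<lambda>n. q (t n))"
  proof (rule CauchyI)
    fix e :: real assume e: "e > 0"
    have "(\<lambda>n. C * cmod (t n)) \<longlonglongrightarrow> 0" using tendsto_mult_right_zero[OF t0] .
    then obtain N where N: "\<And>n. n \<ge> N \<Longrightarrow> C * cmod (t n) < e / 2"
      using order_tendstoD(2)[of _ 0 sequentially "e / 2"] e by (auto simp: eventually_sequentially)
    have "norm (q (t m) - q (t n)) < e" if "m \<ge> N" "n \<ge> N" for m n
      using qq[OF t t, of m n] N[OF that(1)] N[OF that(2)] by (simp add: distrib_left)
    then show "\<exists>M. \<forall>m\<ge>M. \<forall>n\<ge>M. norm (q (t m) - q (t n)) < e" by blast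
  qed
  then obtain D where D: "(\<lambda>n. q (t n)) \<longlonglongrightarrow> D"
    using Cauchy_convergent convergent_def by metis
  \<comment> \<open>\<open>D\<close> is a limit along \<open>t\<close> only; letting the second
    increment run through \<open>t\<close> extends the estimate to all small
    \<open>h\<close>.\<close>
  have qD: "norm (q h - D) \<le> C * cmod h" if h: "cmod h < r" "h \<noteq> 0" for h
  proof (rule LIMSEQ_le)
    show "(\<lambda>n. norm (q h - q (t n))) \<longlonglongrightarrow> norm (q h - D)"
      by (intro tendsto_norm tendsto_diff tendsto_const D)
    show "(\<lambda>n. C * (cmod h + cmod (t n))) \<longlonglongrightarrow> C * cmod h"
      using tendsto_mult[OF tendsto_const tendsto_add[OF tendsto_const t0], of C "cmod h"] by simp
    show "\<exists>N. \<forall>n\<ge>N. norm (q h - q (t n)) \<le> C * (cmod h + cmod (t n))"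
      using qq[OF h t] by blast
  qed
  have "(f has_derivative (\<lambda>h. h *\<^sub>C D)) (at z)"
  proof (rule has_derivativeI_sandwich[OF r bounded_linear_scaleC_left])
    fix y assume y: "y \<noteq> z" "dist y z < r"
    define h where "h = y - z"
    have h: "cmod h < r" "h \<noteq> 0" "y = z + h" using y by (auto simp: h_def dist_norm)
    have "f y - f z - (y - z) *\<^sub>C D = h *\<^sub>C (q h - D)"
      using h by (simp add: q_def complex_vector.scale_right_diff_distrib scaleC_scaleC scaleC_one)
    then show "norm (f y - f z - (y - z) *\<^sub>C D) / norm (y - z) \<le> C * norm (y - z)"
      using qD[OF h(1,2)] h by (simp add: norm_scaleC)
  next
    show "((\<lambda>y. C * norm (y - z)) \<longlongrightarrow> 0) (at z)"
      by (intro tendsto_mult_right_zero tendsto_norm_zero) (simp add: LIM_zero)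
  qed
  then show "\<exists>D. (f has_derivative (\<lambda>h. h *\<^sub>C D)) (at z)" by blast
qed

text \<open>Functionals commute with the derivative, which gives holomorphy; Cauchy's inequality,
  uniformly over \<open>\<Phi>\<close>, gives the local bound on the derivative.\<close>

lemma vector_analytic_on_deriv_z:
  fixes f :: "complex \<Rightarrow> 'b"
  assumes f: "vector_analytic_on f S" and S: "open S"
  shows "vector_analytic_on (deriv_z f) S"
proof (rule vector_analytic_onI[OF S])
  fix \<phi> assume \<phi>: "\<phi> \<in> \<Phi>"
  have "deriv (\<lambda>z. \<phi> (f z)) holomorphic_on S"
    by (intro holomorphic_deriv holomorphic_functional assms \<Phi>_bounded_linear \<Phi>_scale \<phi>)
  then show "(\<lambda>z. \<phi> (deriv_z f z)) holomorphic_on S"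
    by (rule holomorphic_transform)
      (use has_field_derivative_functional[OF f _ \<Phi>_bounded_linear \<Phi>_scale, OF _ \<phi> \<phi>] in \<open>auto dest: DERIV_imp_deriv\<close>)
next
  fix z assume z: "z \<in> S"
  obtain r0 where r0: "r0 > 0" "cball z r0 \<subseteq> S" using S z open_contains_cball by blast
  define r where "r = r0 / 2"
  have r: "r > 0" using r0 by (simp add: r_def)
  have "continuous_on S f" using f by (rule continuous_on_vector_analytic)
  then have "compact (f ` cball z r0)"
    by (rule compact_continuous_image[OF continuous_on_subset[OF _ r0(2)] compact_cball])
  then have "bounded (f ` cball z r0)" by (rule compact_imp_bounded)
  then obtain B where "\<forall>y\<in>f ` cball z r0. norm y \<le> B"
    unfolding bounded_iff by blast
  then have B: "norm (f w) \<le> B" if "w \<in> cball z r0" for w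
    using that by blast
  have B0: "0 \<le> B" using B[of z] r0 norm_ge_zero[of "f z"] by (smt (verit) centre_in_cball)
  have "norm (deriv_z f w) \<le> B / r" if w: "w \<in> S \<inter> ball z r" for w
  proof (rule \<Phi>_norming)
    show "0 \<le> B / r" using B0 r by simp
    fix \<phi> assume \<phi>: "\<phi> \<in> \<Phi>"
    have sub: "cball w r \<subseteq> cball z r0"
    proof
      fix y assume "y \<in> cball w r"
      then show "y \<in> cball z r0"
        using w dist_triangle[of z y w] by (simp add: r_def)
    qed
    have hol: "(\<lambda>z. \<phi> (f z)) holomorphic_on S"
      by (intro holomorphic_functional assms \<Phi>_bounded_linear \<Phi>_scale \<phi>)
    have "cmod ((deriv ^^ 1) (\<lambda>z. \<phi> (f z)) w) \<le> fact 1 * B / r ^ 1"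
    proof (rule Cauchy_inequality[OF _ _ r])
      show "(\<lambda>z. \<phi> (f z)) holomorphic_on ball w r"
        using holomorphic_on_subset[OF hol] sub r0 ball_subset_cball by (meson subset_trans)
      show "continuous_on (cball w r) (\<lambda>z. \<phi> (f z))"
        using continuous_on_subset[OF holomorphic_on_imp_continuous_on[OF hol]] sub r0 by (meson subset_trans)
      show "cmod (\<phi> (f x)) \<le> B" if "cmod (w - x) = r" for x
        using B[of x] \<Phi>_bound[OF \<phi>, of "f x"] sub that by (force simp: dist_norm)
    qed
    moreover have "deriv (\<lambda>z. \<phi> (f z)) w = \<phi> (deriv_z f w)"
      using w by (intro DERIV_imp_deriv has_field_derivative_functional[OF f]
          \<Phi>_bounded_linear \<Phi>_scale \<phi>) auto
    ultimately show "cmod (\<phi> (deriv_z f w)) \<le> B / r" by simp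
  qed
  then show "\<exists>r>0. \<exists>B. \<forall>w\<in>S \<inter> ball z r. norm (deriv_z f w) \<le> B" using r by blast
qed

text \<open>\<open>\<Phi>\<close> serves to make all iterated derivatives analytic. The functional
  \<phi> may be any bounded complex-linear one, so matrix entries with vectors of arbitrary length
  are covered.\<close>

lemma functional_higher_deriv_z:
  fixes \<phi> :: "'b \<Rightarrow> complex"
  assumes f: "vector_analytic_on f S" and S: "open S" and z: "z \<in> S"
    and \<phi>: "bounded_linear \<phi>" "\<And>c x. \<phi> (c *\<^sub>C x) = c * \<phi> x"
  shows "\<phi> ((deriv_z ^^ n) f z) = (deriv ^^ n) (\<lambda>z. \<phi> (f z)) z"
  using z
proof (induction n arbitrary: z)
  case (Suc n)
  have an: "vector_analytic_on ((deriv_z ^^ n) f) S"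
    by (induction n) (simp_all add: f vector_analytic_on_deriv_z S)
  have "deriv ((deriv ^^ n) (\<lambda>z. \<phi> (f z))) z = deriv (\<lambda>z. \<phi> ((deriv_z ^^ n) f z)) z"
  proof (rule deriv_cong_ev[OF _ refl])
    show "\<forall>\<^sub>F x in nhds z. (deriv ^^ n) (\<lambda>z. \<phi> (f z)) x = \<phi> ((deriv_z ^^ n) f x)"
      using eventually_nhds_in_open[OF S Suc.prems] by eventually_elim (simp add: Suc.IH)
  qed
  also have "\<dots> = \<phi> (deriv_z ((deriv_z ^^ n) f) z)"
    by (rule DERIV_imp_deriv[OF has_field_derivative_functional[OF an Suc.prems \<phi>]])
  finally show ?case by simp
qed simp

end

section \<open>Inner products on a Hilbert space type\<close>

instance chilbert_space \<subseteq> banach ..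

interpretation cinner: ip_space UNIV "cinner :: 'e::complex_inner \<Rightarrow> 'e \<Rightarrow> complex"
  rewrites ip_norm_cinner: "ip_norm cinner = (norm :: 'e \<Rightarrow> real)"
proof -
  show "ip_norm cinner = (norm :: 'e \<Rightarrow> real)"
    by (auto simp: ip_norm_def norm_eq_sqrt_cinner fun_eq_iff)
  show "ip_space UNIV (cinner :: 'e \<Rightarrow> 'e \<Rightarrow> complex)"
  proof
    fix x y :: 'e
    show "cinner x y = cnj (cinner y x)" by (rule cinner_commute)
    assume "x \<noteq> 0"
    then have "0 < sqrt (Re (cinner x x))" by (simp flip: norm_eq_sqrt_cinner)
    then show "0 < Re (cinner x x)" by simp
  qed (simp_all add: cinner_add_left cinner_scaleC_left)
qed

lemma bounded_linear_cinner_left: "bounded_linear (\<lambda>x. cinner x \<eta>)"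
  using cinner.Cauchy_Schwarz[of _ \<eta>]
  by (intro bounded_linear_intro[where K = "norm \<eta>"])
    (simp_all add: cinner_add_left scaleR_scaleC cinner_scaleC_left scaleC_complex_def)

lemma norm_le_if_cinner_le:
  fixes x :: "'e::complex_inner"
  assumes "0 \<le> c" "\<And>y. norm y \<le> 1 \<Longrightarrow> cmod (cinner x y) \<le> c"
  shows "norm x \<le> c"
proof (cases "x = 0")
  case False
  define y where "y = of_real (1 / norm x) *\<^sub>C x"
  have "norm y \<le> 1" unfolding y_def norm_scaleC norm_of_real using False by simp
  moreover have "cinner x y = of_real (norm x)"
    using False by (simp add: y_def cinner.ip_scale_right cinner.ip_self power2_eq_square)
  ultimately show ?thesis using assms(2)[of y] by simp
qed (use assms in simp)

lemma norming_operator: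
  "norming {(\<lambda>A :: 'e \<Rightarrow>\<^sub>L 'e. cinner (blinfun_apply A \<xi>) \<eta>) | \<xi> \<eta> :: 'e::chilbert_space. norm \<xi> \<le> 1 \<and> norm \<eta> \<le> 1}"
    (is "norming ?\<Phi>")
proof
  fix \<phi> and A :: "'e \<Rightarrow>\<^sub>L 'e" assume "\<phi> \<in> ?\<Phi>"
  then obtain \<xi> \<eta> where \<eta>: "\<phi> = (\<lambda>A. cinner (blinfun_apply A \<xi>) \<eta>)" "norm \<xi> \<le> 1" "norm \<eta> \<le> 1" by blast
  have "cmod (\<phi> A) \<le> norm (blinfun_apply A \<xi>) * norm \<eta>"
    using cinner.Cauchy_Schwarz[of "blinfun_apply A \<xi>" \<eta>] \<eta> by simp
  also have "\<dots> \<le> norm A * norm \<xi> * norm \<eta>"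
    by (intro mult_right_mono norm_blinfun) auto
  also have "\<dots> \<le> norm A * 1 * 1"
    using \<eta> by (intro mult_mono) auto
  finally show "cmod (\<phi> A) \<le> norm A" by simp
next
  fix A :: "'e \<Rightarrow>\<^sub>L 'e" and c :: real
  assume c: "0 \<le> c" and A: "\<And>\<phi>. \<phi> \<in> ?\<Phi> \<Longrightarrow> cmod (\<phi> A) \<le> c"
  show "norm A \<le> c"
  proof (rule norm_blinfun_bound[OF c])
    fix x
    have unit: "norm (blinfun_apply A \<xi>) \<le> c" if "norm \<xi> \<le> 1" for \<xi>
      by (rule norm_le_if_cinner_le) (use c A that in auto)
    show "norm (blinfun_apply A x) \<le> c * norm x"
    proof (cases "x = 0")
      case False
      \<comment> \<open>The type contains all bounded real-linear maps, so x is normalized by a real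
        scalar, which may be moved through \<open>A\<close>.\<close>
      have "norm (blinfun_apply A ((1 / norm x) *\<^sub>R x)) \<le> c" using False by (intro unit) simp
      then show ?thesis using False by (simp add: blinfun.scaleR_right field_simps)
    qed simp
  qed
qed (auto simp: cinner_add_left cinner_scaleC_left plus_blinfun.rep_eq scaleC_blinfun.rep_eq)

section \<open>Analytic reproducing kernel Hilbert spaces\<close>

text \<open>Reflecting a holomorphic function in the real axis conjugates its derivatives. This
  handles the second variable of the kernel, where matrix entries are such reflections.\<close>

lemma higher_deriv_cnj_cnj:
  assumes g: "g holomorphic_on ball 0 r" and z: "z \<in> ball 0 r"
  shows "(deriv ^^ n) (\<lambda>v. cnj (g (cnj v))) z = cnj ((deriv ^^ n) g (cnj z))"
  using z
proof (induction n arbitrary: z)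
  case (Suc n)
  have "deriv ((deriv ^^ n) (\<lambda>v. cnj (g (cnj v)))) z = deriv (cnj \<circ> (deriv ^^ n) g \<circ> cnj) z"
  proof (rule deriv_cong_ev[OF _ refl])
    show "\<forall>\<^sub>F v in nhds z. (deriv ^^ n) (\<lambda>v. cnj (g (cnj v))) v = (cnj \<circ> (deriv ^^ n) g \<circ> cnj) v"
      using eventually_nhds_in_open[OF open_ball Suc.prems] by eventually_elim (simp add: Suc.IH)
  qed
  also have "\<dots> = cnj (deriv ((deriv ^^ n) g) (cnj z))"
  proof (intro DERIV_imp_deriv has_field_derivative_cnj_cnj holomorphic_derivI[OF _ open_ball])
    show "(deriv ^^ n) g holomorphic_on ball 0 r" using g by (intro holomorphic_higher_deriv) auto
    show "cnj z \<in> ball 0 r" using Suc.prems by simp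
  qed
  finally show ?case by simp
qed simp

lemma eq_0_if_cinner_eq_0:
  assumes "closure E = UNIV" "\<And>\<eta>. \<eta> \<in> E \<Longrightarrow> cinner x \<eta> = 0"
  shows "x = (0 :: 'e::complex_inner)"
proof (rule ccontr)
  assume "x \<noteq> 0"
  then have nx: "norm x > 0" by simp
  have "x \<in> closure E" using assms(1) by simp
  \<comment> \<open>Since \<open>y\<close> is orthogonal to \<open>x\<close>, the squared norm of
    \<open>x\<close> equals the product of \<open>x\<close> with \<open>x - y\<close>, which this
    radius makes strictly smaller.\<close>
  then obtain y where y: "y \<in> E" "norm (y - x) < norm x"
    using nx unfolding closure_approachable dist_norm by blast
  have "(norm x)\<^sup>2 = cmod (cinner x x)" by (simp add: cinner.ip_self norm_power)
  also have "cinner x x = cinner x (x - y)" using assms(2)[OF y(1)] by (simp add: cinner.ip_diff_right)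
  also have "cmod \<dots> \<le> norm x * norm (x - y)" using cinner.Cauchy_Schwarz[of x "x - y"] by simp
  also have "\<dots> < norm x * norm x" using y nx by (simp add: norm_minus_commute)
  finally show False by (simp add: power2_eq_square)
qed

locale rkhs =
  fixes K :: "complex \<Rightarrow> complex \<Rightarrow> ('e::chilbert_space \<Rightarrow>\<^sub>L 'e)"
    and H :: "(complex \<Rightarrow> 'e) set"
    and ip :: "(complex \<Rightarrow> 'e) \<Rightarrow> (complex \<Rightarrow> 'e) \<Rightarrow> complex"
  assumes rkhs: "analytic_rkhs K H ip"

sublocale rkhs \<subseteq> hilbert H ip
proof -
  have h: "hilbert_space_on H ip" using rkhs by (simp add: analytic_rkhs_def)
  interpret ip_space H ip using h by (rule ip_space_if_hilbert_space_on)
  show "hilbert H ip" by unfold_locales (use h in \<open>simp add: hilbert_space_on_def\<close>)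
qed

context rkhs
begin

section \<open>Kernel functions and point evaluations\<close>

lemma analytic: "f \<in> H \<Longrightarrow> vector_analytic_on f unit_disc"
  and zero_off_disc: "\<lbrakk>f \<in> H; z \<notin> unit_disc\<rbrakk> \<Longrightarrow> f z = 0"
  and kernel_mem: "w \<in> unit_disc \<Longrightarrow> kernel_fun K w \<eta> \<in> H"
  and reproducing: "\<lbrakk>f \<in> H; w \<in> unit_disc\<rbrakk> \<Longrightarrow> ip f (kernel_fun K w \<eta>) = cinner (f w) \<eta>"
  using rkhs unfolding analytic_rkhs_def by blast+

lemma cinner_kernel:
  assumes "u \<in> unit_disc" "v \<in> unit_disc"
  shows "cinner (blinfun_apply (K u v) \<xi>) \<eta> = ip (kernel_fun K v \<xi>) (kernel_fun K u \<eta>)"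
  using reproducing[OF kernel_mem[OF assms(2)] assms(1)] assms by (simp add: kernel_fun_def)

lemma holomorphic_cinner: "f \<in> H \<Longrightarrow> (\<lambda>z. cinner (f z) \<eta>) holomorphic_on unit_disc"
  by (intro holomorphic_functional analytic open_ball bounded_linear_cinner_left cinner_scaleC_left)

text \<open>A bound at each single point, with no control as \<open>w\<close> varies; it supplies
  the boundedness of the individual evaluations in the uniform boundedness argument.\<close>

lemma nrm_kernel_le: "w \<in> unit_disc \<Longrightarrow> nrm (kernel_fun K w \<eta>) \<le> sqrt (norm (K w w)) * norm \<eta>"
proof -
  assume w: "w \<in> unit_disc"
  have "Re (ip (kernel_fun K w \<eta>) (kernel_fun K w \<eta>)) \<le> cmod (cinner (blinfun_apply (K w w) \<eta>) \<eta>)"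
    by (simp add: cinner_kernel[OF w w] complex_Re_le_cmod)
  also have "\<dots> \<le> norm (blinfun_apply (K w w) \<eta>) * norm \<eta>"
    using cinner.Cauchy_Schwarz by simp
  also have "\<dots> \<le> norm (K w w) * norm \<eta> * norm \<eta>"
    by (intro mult_right_mono norm_blinfun) auto
  finally show ?thesis
    unfolding ip_norm_def using real_sqrt_le_mono by (fastforce simp: real_sqrt_mult mult.assoc)
qed

text \<open>The reproducing property with \<eta> = f(w), followed by Cauchy-Schwarz and cancellation
  of the norm of f(w).\<close>

lemma norm_eval_le:
  assumes f: "f \<in> H" and w: "w \<in> unit_disc"
    and c: "0 \<le> c" "nrm (kernel_fun K w (f w)) \<le> c * norm (f w)"
  shows "norm (f w) \<le> c * nrm f"
proof (cases "f w = 0")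
  case False
  have "(norm (f w))\<^sup>2 = cmod (ip f (kernel_fun K w (f w)))"
    using f w by (simp add: reproducing cinner.ip_self norm_power)
  also have "\<dots> \<le> nrm f * nrm (kernel_fun K w (f w))"
    using f w by (intro Cauchy_Schwarz kernel_mem)
  also have "\<dots> \<le> nrm f * (c * norm (f w))"
    using f c by (intro mult_left_mono) auto
  finally have "norm (f w) * norm (f w) \<le> (c * nrm f) * norm (f w)"
    by (simp add: power2_eq_square mult_ac)
  then show ?thesis using False by simp
qed (use f c in simp)

text \<open>The kernel is only assumed to be separately analytic, so its local boundedness on the diagonal
  is not immediate; it follows from the uniform boundedness principle in the space itself.\<close>

lemma eval_bounded:
  assumes "r < 1"
  shows "\<exists>C\<ge>0. \<forall>z\<in>cball 0 r. \<forall>f\<in>H. norm (f z) \<le> C * nrm f"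
proof (rule uniform_boundedness)
  have sub: "cball 0 r \<subseteq> unit_disc" using assms by (auto simp: subset_iff)
  show "norm ((f + g) z) \<le> norm (f z) + norm (g z)" for f g :: "complex \<Rightarrow> 'e" and z
    by (simp add: norm_triangle_ineq)
  show "norm ((c *\<^sub>C f) z) = cmod c * norm (f z)" for f :: "complex \<Rightarrow> 'e" and c z
    by (simp add: scaleC_fun_def norm_scaleC)
  show "\<exists>C. \<forall>f\<in>H. norm (f z) \<le> C * nrm f" if "z \<in> cball 0 r" for z
    using norm_eval_le nrm_kernel_le sub that by (meson real_sqrt_ge_zero norm_ge_zero subsetD)
  show "\<exists>B. \<forall>z\<in>cball 0 r. norm (f z) \<le> B" if f: "f \<in> H" for f
  proof -
    have "compact (f ` cball 0 r)"
      by (rule compact_continuous_image[OF continuous_on_subset[OF _ sub] compact_cball])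
        (rule continuous_on_vector_analytic[OF analytic[OF f]])
    then have "bounded (f ` cball 0 r)" by (rule compact_imp_bounded)
    then show ?thesis unfolding bounded_iff by blast
  qed
qed

text \<open>\<open>kernel_fun K z\<close> is the adjoint of evaluation at \<open>z\<close>, so it
  inherits the bound: the squared norm of a kernel function is its own value at \<open>z\<close>
  paired with \<eta>.\<close>

lemma kernel_bounded:
  assumes "r < 1"
  shows "\<exists>C\<ge>0. \<forall>z\<in>cball 0 r. \<forall>\<eta>. nrm (kernel_fun K z \<eta>) \<le> C * norm \<eta>"
proof -
  obtain C where C: "C \<ge> 0" "\<And>z f. \<lbrakk>z \<in> cball 0 r; f \<in> H\<rbrakk> \<Longrightarrow> norm (f z) \<le> C * nrm f"
    using eval_bounded[OF assms] by blast
  have "nrm (kernel_fun K z \<eta>) \<le> C * norm \<eta>" if z: "z \<in> cball 0 r" for z \<eta>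
  proof (cases "nrm (kernel_fun K z \<eta>) = 0")
    case False
    let ?k = "kernel_fun K z \<eta>"
    have zd: "z \<in> unit_disc" using z assms by simp
    then have k: "?k \<in> H" by (rule kernel_mem)
    have "(nrm ?k)\<^sup>2 = cmod (cinner (?k z) \<eta>)"
      using k ip_self[OF k] reproducing[OF k zd, of \<eta>] by (metis norm_of_real abs_power2)
    also have "\<dots> \<le> norm (?k z) * norm \<eta>" using cinner.Cauchy_Schwarz by simp
    also have "\<dots> \<le> C * nrm ?k * norm \<eta>" using C(2)[OF z k] by (intro mult_right_mono) auto
    finally have "nrm ?k * nrm ?k \<le> nrm ?k * (C * norm \<eta>)"
      by (simp add: power2_eq_square mult_ac)
    moreover have "nrm ?k > 0" using False nrm_nonneg[OF k] by linarith
    ultimately show ?thesis by (simp only: mult_le_cancel_left_pos)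
  qed (use C in simp)
  then show ?thesis using C by blast
qed

section \<open>Taylor coefficients at 0 as bounded functionals\<close>

definition coef :: "nat \<Rightarrow> 'e \<Rightarrow> (complex \<Rightarrow> 'e) \<Rightarrow> complex"
  where "coef n \<eta> f = (deriv ^^ n) (\<lambda>z. cinner (f z) \<eta>) 0 / fact n"

lemma coef_bounded: "\<exists>C\<ge>0. \<forall>\<eta>. \<forall>f\<in>H. cmod (coef n \<eta> f) \<le> C * norm \<eta> * nrm f"
proof -
  \<comment> \<open>Cauchy's inequality is applied on the circle of radius 1/2, whence the factor
    \<open>2 ^ n\<close>. The constant is uniform in \<eta>, as the later operator bounds
    require.\<close>
  obtain C where C: "C \<ge> 0" "\<And>z f. \<lbrakk>z \<in> cball 0 (1/2); f \<in> H\<rbrakk> \<Longrightarrow> norm (f z) \<le> C * nrm f"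
    using eval_bounded[of "1/2"] by auto
  have "cmod (coef n \<eta> f) \<le> 2 ^ n * C * norm \<eta> * nrm f" if f: "f \<in> H" for \<eta> f
  proof -
    have "cmod ((deriv ^^ n) (\<lambda>z. cinner (f z) \<eta>) 0) \<le> fact n * (C * nrm f * norm \<eta>) / (1/2) ^ n"
    proof (rule Cauchy_inequality)
      show "(\<lambda>z. cinner (f z) \<eta>) holomorphic_on ball 0 (1/2)"
        using holomorphic_cinner[OF f] by (rule holomorphic_on_subset) auto
      show "continuous_on (cball 0 (1/2)) (\<lambda>z. cinner (f z) \<eta>)"
        using holomorphic_on_imp_continuous_on[OF holomorphic_cinner[OF f]]
        by (rule continuous_on_subset) auto
      show "cmod (cinner (f x) \<eta>) \<le> C * nrm f * norm \<eta>" if "cmod (0 - x) = 1/2" for x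
      proof -
        have "cmod (cinner (f x) \<eta>) \<le> norm (f x) * norm \<eta>" using cinner.Cauchy_Schwarz by simp
        also have "\<dots> \<le> C * nrm f * norm \<eta>"
          using C(2)[OF _ f, of x] that by (intro mult_right_mono) auto
        finally show ?thesis .
      qed
    qed simp
    then have "cmod (coef n \<eta> f) \<le> (C * nrm f * norm \<eta>) / (1/2) ^ n"
      by (simp add: coef_def norm_divide divide_simps mult_ac)
    then show ?thesis by (simp add: power_one_over mult_ac)
  qed
  moreover have "2 ^ n * C \<ge> 0" using C by simp
  ultimately show ?thesis by blast
qed

text \<open>The Riesz vector of \<open>coef n \<eta>\<close>. As a function of u it turns out to be
  the n-th conjugate derivative of K(u, w) at w = 0, applied to \<eta> and divided by n!.\<close>

definition coef_rep :: "nat \<Rightarrow> 'e \<Rightarrow> complex \<Rightarrow> 'e"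
  where "coef_rep n \<eta> = (SOME k. k \<in> H \<and> (\<forall>f\<in>H. coef n \<eta> f = ip f k))"

lemma coef_rep: "coef_rep n \<eta> \<in> H \<and> (\<forall>f\<in>H. coef n \<eta> f = ip f (coef_rep n \<eta>))"
proof -
  obtain C where C: "\<And>f. f \<in> H \<Longrightarrow> cmod (coef n \<eta> f) \<le> C * norm \<eta> * nrm f"
    using coef_bounded by blast
  have "\<exists>k\<in>H. \<forall>f\<in>H. coef n \<eta> f = ip f k"
  proof (rule Riesz)
    show "coef n \<eta> (f + g) = coef n \<eta> f + coef n \<eta> g" if "f \<in> H" "g \<in> H" for f g
      using higher_deriv_add[OF holomorphic_cinner holomorphic_cinner open_ball, of f g 0 n \<eta> \<eta>] that
      by (simp add: coef_def cinner_add_left add_divide_distrib)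
    show "coef n \<eta> (c *\<^sub>C f) = c * coef n \<eta> f" if "f \<in> H" for c f
      using higher_deriv_cmult[OF holomorphic_cinner[of f \<eta>], of 0 n c] that
      by (simp add: coef_def scaleC_fun_def cinner_scaleC_left)
  qed (rule C)
  then have "\<exists>k. k \<in> H \<and> (\<forall>f\<in>H. coef n \<eta> f = ip f k)" by blast
  then show ?thesis unfolding coef_rep_def by (rule someI_ex)
qed

lemma coef_rep_mem: "coef_rep n \<eta> \<in> H"
  and ip_coef_rep: "f \<in> H \<Longrightarrow> ip f (coef_rep n \<eta>) = coef n \<eta> f"
  using coef_rep by simp_all

lemma coef_rep_bounded: "\<exists>C\<ge>0. \<forall>\<eta>. nrm (coef_rep n \<eta>) \<le> C * norm \<eta>"
proof -
  obtain C where C: "C \<ge> 0" "\<And>\<eta> f. f \<in> H \<Longrightarrow> cmod (coef n \<eta> f) \<le> C * norm \<eta> * nrm f"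
    using coef_bounded by blast
  have "nrm (coef_rep n \<eta>) \<le> C * norm \<eta>" for \<eta>
  proof (cases "nrm (coef_rep n \<eta>) = 0")
    case False
    let ?k = "coef_rep n \<eta>"
    have "(nrm ?k)\<^sup>2 = cmod (coef n \<eta> ?k)"
      using ip_self[OF coef_rep_mem] ip_coef_rep[OF coef_rep_mem] by (metis norm_of_real abs_power2)
    also have "\<dots> \<le> C * norm \<eta> * nrm ?k" by (rule C(2)[OF coef_rep_mem])
    finally have "nrm ?k * nrm ?k \<le> nrm ?k * (C * norm \<eta>)"
      by (simp add: power2_eq_square mult_ac)
    moreover have "nrm ?k > 0" using False nrm_nonneg[OF coef_rep_mem, of n \<eta>] by linarith
    ultimately show ?thesis by (simp only: mult_le_cancel_left_pos)
  qed (use C in simp)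
  then show ?thesis using C by blast
qed

section \<open>Derivatives of the kernel at the origin\<close>

lemma cinner_coef_rep:
  assumes u: "u \<in> unit_disc"
  shows "cinner (coef_rep n \<xi> u) \<eta> = cnj (coef n \<xi> (kernel_fun K u \<eta>))"
  using reproducing[OF coef_rep_mem u] ip_commute[OF coef_rep_mem kernel_mem[OF u]]
    ip_coef_rep[OF kernel_mem[OF u]] by simp

text \<open>By the symmetry of \<open>ip\<close>, the entry of K(u, cnj v) is the reflection of v to
  the value at v of the kernel function of u, paired with \<xi>. Its n-th derivative at 0 is n!
  times a conjugated Taylor coefficient of that kernel function, which the reproducing property
  reads off from \<open>coef_rep n \<xi>\<close> at u.\<close>

lemma cinner_higher_deriv_zbar_kernel:
  assumes u: "u \<in> unit_disc"
  shows "cinner (blinfun_apply ((deriv_zbar ^^ n) (K u) 0) \<xi>) \<eta> = fact n * cinner (coef_rep n \<xi> u) \<eta>"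
proof -
  interpret norming "{(\<lambda>A :: 'e \<Rightarrow>\<^sub>L 'e. cinner (blinfun_apply A \<xi>) \<eta>) | \<xi> \<eta>. norm \<xi> \<le> 1 \<and> norm \<eta> \<le> 1}"
    by (rule norming_operator)
  have conj: "cinner (blinfun_apply (K u (cnj v)) \<xi>) \<eta> = cnj (cinner (kernel_fun K u \<eta> (cnj v)) \<xi>)"
    if "v \<in> unit_disc" for v \<xi> \<eta>
  proof -
    have v: "cnj v \<in> unit_disc" using that by simp
    have "cinner (blinfun_apply (K u (cnj v)) \<xi>) \<eta> = ip (kernel_fun K (cnj v) \<xi>) (kernel_fun K u \<eta>)"
      by (rule cinner_kernel[OF u v])
    also have "\<dots> = cnj (ip (kernel_fun K u \<eta>) (kernel_fun K (cnj v) \<xi>))"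
      by (rule ip_commute[OF kernel_mem[OF v] kernel_mem[OF u]])
    finally show ?thesis by (simp only: reproducing[OF kernel_mem[OF u] v])
  qed
  have hol: "(\<lambda>v. cnj (cinner (kernel_fun K u \<eta> (cnj v)) \<xi>)) holomorphic_on unit_disc" for \<xi> \<eta>
  proof -
    have "cnj ` unit_disc \<subseteq> unit_disc" by auto
    then have "cnj \<circ> (\<lambda>v. cinner (kernel_fun K u \<eta> v) \<xi>) \<circ> cnj holomorphic_on unit_disc"
      using holomorphic_on_subset[OF holomorphic_cinner[OF kernel_mem[OF u]]]
      by (intro holomorphic_on_compose_cnj_cnj) auto
    then show ?thesis by (simp add: o_def)
  qed
  \<comment> \<open>Needed in operator norm: only then does the iterated derivative exist and
    commute with taking matrix entries.\<close>
  have an: "vector_analytic_on (\<lambda>v. K u (cnj v)) unit_disc"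
  proof (rule vector_analytic_onI)
    fix \<phi> :: "('e \<Rightarrow>\<^sub>L 'e) \<Rightarrow> complex"
    assume "\<phi> \<in> {(\<lambda>A. cinner (blinfun_apply A \<xi>) \<eta>) | \<xi> \<eta>. norm \<xi> \<le> 1 \<and> norm \<eta> \<le> 1}"
    then obtain \<xi> \<eta> where \<phi>: "\<phi> = (\<lambda>A. cinner (blinfun_apply A \<xi>) \<eta>)" by blast
    show "(\<lambda>v. \<phi> (K u (cnj v))) holomorphic_on unit_disc"
      unfolding \<phi> by (rule holomorphic_transform[OF hol]) (simp only: conj)
  next
    fix z :: complex assume z: "z \<in> unit_disc"
    \<comment> \<open>Large enough for \<open>u\<close> and for the whole ball of radius (1 - |z|) /
      2 about z, whose points have modulus below (1 + |z|) / 2.\<close>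
    define r where "r = max (cmod u) ((1 + cmod z) / 2)"
    have r: "r < 1" using z u by (simp add: r_def)
    obtain C where C: "C \<ge> 0" "\<And>z \<eta>. z \<in> cball 0 r \<Longrightarrow> nrm (kernel_fun K z \<eta>) \<le> C * norm \<eta>"
      using kernel_bounded[OF r] by blast
    have "norm (K u (cnj v)) \<le> C * C" if v: "v \<in> unit_disc \<inter> ball z ((1 - cmod z) / 2)" for v
    proof (rule \<Phi>_norming)
      show "0 \<le> C * C" by simp
      fix \<phi> :: "('e \<Rightarrow>\<^sub>L 'e) \<Rightarrow> complex"
      assume "\<phi> \<in> {(\<lambda>A. cinner (blinfun_apply A \<xi>) \<eta>) | \<xi> \<eta>. norm \<xi> \<le> 1 \<and> norm \<eta> \<le> 1}"
      then obtain \<xi> \<eta> where \<phi>: "\<phi> = (\<lambda>A. cinner (blinfun_apply A \<xi>) \<eta>)" "norm \<xi> \<le> 1" "norm \<eta> \<le> 1" by blast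
      have "cmod v \<le> cmod z + cmod (v - z)" using norm_triangle_ineq[of z "v - z"] by simp
      then have vr: "cnj v \<in> cball 0 r" using v by (simp add: r_def dist_norm norm_minus_commute le_max_iff_disj)
      have ur: "u \<in> cball 0 r" by (simp add: r_def)
      have v': "cnj v \<in> unit_disc" using v by simp
      have "cmod (\<phi> (K u (cnj v))) \<le> nrm (kernel_fun K (cnj v) \<xi>) * nrm (kernel_fun K u \<eta>)"
        unfolding \<phi>(1) cinner_kernel[OF u v'] by (intro Cauchy_Schwarz kernel_mem u v')
      also have "\<dots> \<le> (C * norm \<xi>) * (C * norm \<eta>)"
        using C(1) kernel_mem[OF u] by (intro mult_mono C(2) vr ur) auto
      also have "\<dots> \<le> (C * 1) * (C * 1)"
        using C(1) \<phi> by (intro mult_mono) auto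
      finally show "cmod (\<phi> (K u (cnj v))) \<le> C * C" by simp
    qed
    moreover have "(1 - cmod z) / 2 > 0" using z by simp
    ultimately show "\<exists>r>0. \<exists>B. \<forall>w\<in>unit_disc \<inter> ball z r. norm (K u (cnj w)) \<le> B" by blast
  qed simp
  have "cinner (blinfun_apply ((deriv_zbar ^^ n) (K u) 0) \<xi>) \<eta>
      = cinner (blinfun_apply ((deriv_z ^^ n) (\<lambda>v. K u (cnj v)) 0) \<xi>) \<eta>"
    by (simp add: higher_deriv_zbar_eq)
  also have "\<dots> = (deriv ^^ n) (\<lambda>v. cinner (blinfun_apply (K u (cnj v)) \<xi>) \<eta>) 0"
    by (rule functional_higher_deriv_z[OF an])
      (auto simp: scaleC_blinfun.rep_eq cinner_scaleC_left
        intro: bounded_linear_compose[OF bounded_linear_cinner_left blinfun.bounded_linear_left])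
  also have "\<dots> = (deriv ^^ n) (\<lambda>v. cnj (cinner (kernel_fun K u \<eta> (cnj v)) \<xi>)) 0"
  proof (rule higher_deriv_cong_ev[OF _ refl])
    show "\<forall>\<^sub>F v in nhds 0. cinner (blinfun_apply (K u (cnj v)) \<xi>) \<eta>
        = cnj (cinner (kernel_fun K u \<eta> (cnj v)) \<xi>)"
      using eventually_nhds_in_open[of unit_disc 0] conj by (auto elim: eventually_mono)
  qed
  also have "\<dots> = cnj ((deriv ^^ n) (\<lambda>v. cinner (kernel_fun K u \<eta> v) \<xi>) 0)"
    using higher_deriv_cnj_cnj[OF holomorphic_cinner[OF kernel_mem[OF u]], of 0] by simp
  also have "\<dots> = fact n * cinner (coef_rep n \<xi> u) \<eta>"
    by (simp add: cinner_coef_rep[OF u] coef_def)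
  finally show ?thesis .
qed

text \<open>One n! comes from the conjugate derivative, the other from reading the n-th Taylor
  coefficient of \<open>coef_rep n \<xi>\<close> as an inner product.\<close>

lemma cinner_mixed_deriv:
  "cinner (blinfun_apply (mixed_deriv n K 0 0) \<xi>) \<eta> = (fact n)\<^sup>2 * ip (coef_rep n \<xi>) (coef_rep n \<eta>)"
proof -
  let ?A = "\<lambda>u. (deriv_zbar ^^ n) (K u) 0"
  interpret norming "{(\<lambda>A :: 'e \<Rightarrow>\<^sub>L 'e. cinner (blinfun_apply A \<xi>) \<eta>) | \<xi> \<eta>. norm \<xi> \<le> 1 \<and> norm \<eta> \<le> 1}"
    by (rule norming_operator)
  have hol: "(\<lambda>u. fact n * cinner (coef_rep n \<xi> u) \<eta>) holomorphic_on unit_disc" for \<xi> \<eta>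
    by (intro holomorphic_intros holomorphic_cinner coef_rep_mem)
  have an: "vector_analytic_on ?A unit_disc"
  proof (rule vector_analytic_onI)
    fix \<phi> :: "('e \<Rightarrow>\<^sub>L 'e) \<Rightarrow> complex"
    assume "\<phi> \<in> {(\<lambda>A. cinner (blinfun_apply A \<xi>) \<eta>) | \<xi> \<eta>. norm \<xi> \<le> 1 \<and> norm \<eta> \<le> 1}"
    then obtain \<xi> \<eta> where \<phi>: "\<phi> = (\<lambda>A. cinner (blinfun_apply A \<xi>) \<eta>)" by blast
    show "(\<lambda>u. \<phi> (?A u)) holomorphic_on unit_disc"
      unfolding \<phi> by (rule holomorphic_transform[OF hol]) (simp only: cinner_higher_deriv_zbar_kernel)
  next
    fix z :: complex assume z: "z \<in> unit_disc"
    define r where "r = (1 + cmod z) / 2"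
    have r: "r < 1" using z by (simp add: r_def)
    obtain C where C: "C \<ge> 0" "\<And>z f. \<lbrakk>z \<in> cball 0 r; f \<in> H\<rbrakk> \<Longrightarrow> norm (f z) \<le> C * nrm f"
      using eval_bounded[OF r] by blast
    obtain C' where C': "C' \<ge> 0" "\<And>\<eta>. nrm (coef_rep n \<eta>) \<le> C' * norm \<eta>"
      using coef_rep_bounded by blast
    \<comment> \<open>\<open>C\<close> bounds evaluation at points near \<open>z\<close> and
      \<open>C'\<close> bounds \<open>coef_rep n\<close> as a map of its vector argument; together
      they control all matrix entries with unit-ball vectors.\<close>
    have "norm (?A u) \<le> fact n * (C * C')" if u: "u \<in> unit_disc \<inter> ball z ((1 - cmod z) / 2)" for u
    proof (rule \<Phi>_norming)
      show "0 \<le> fact n * (C * C')" using C C' by simp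
      fix \<phi> :: "('e \<Rightarrow>\<^sub>L 'e) \<Rightarrow> complex"
      assume "\<phi> \<in> {(\<lambda>A. cinner (blinfun_apply A \<xi>) \<eta>) | \<xi> \<eta>. norm \<xi> \<le> 1 \<and> norm \<eta> \<le> 1}"
      then obtain \<xi> \<eta> where \<phi>: "\<phi> = (\<lambda>A. cinner (blinfun_apply A \<xi>) \<eta>)" "norm \<xi> \<le> 1" "norm \<eta> \<le> 1" by blast
      have "cmod u \<le> cmod z + cmod (u - z)" using norm_triangle_ineq[of z "u - z"] by simp
      then have ur: "u \<in> cball 0 r" using u by (simp add: r_def dist_norm norm_minus_commute)
      have u': "u \<in> unit_disc" using u by simp
      have "cmod (\<phi> (?A u)) = fact n * cmod (cinner (coef_rep n \<xi> u) \<eta>)"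
        unfolding \<phi>(1) cinner_higher_deriv_zbar_kernel[OF u'] by (simp add: norm_mult)
      also have "\<dots> \<le> fact n * (norm (coef_rep n \<xi> u) * norm \<eta>)"
        using cinner.Cauchy_Schwarz by (intro mult_left_mono) auto
      also have "\<dots> \<le> fact n * ((C * (C' * norm \<xi>)) * norm \<eta>)"
        using C(2)[OF ur coef_rep_mem, of n \<xi>] mult_left_mono[OF C'(2)[of \<xi>] C(1)]
        by (intro mult_left_mono mult_right_mono) auto
      also have "\<dots> \<le> fact n * ((C * (C' * 1)) * 1)"
        using C C' \<phi> by (intro mult_mono) auto
      finally show "cmod (\<phi> (?A u)) \<le> fact n * (C * C')" by simp
    qed
    moreover have "(1 - cmod z) / 2 > 0" using z by simp
    ultimately show "\<exists>r>0. \<exists>B. \<forall>u\<in>unit_disc \<inter> ball z r. norm (?A u) \<le> B" by blast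
  qed simp
  have "cinner (blinfun_apply (mixed_deriv n K 0 0) \<xi>) \<eta> = (deriv ^^ n) (\<lambda>u. cinner (blinfun_apply (?A u) \<xi>) \<eta>) 0"
    unfolding mixed_deriv_def
    by (rule functional_higher_deriv_z[OF an])
      (auto simp: scaleC_blinfun.rep_eq cinner_scaleC_left
        intro: bounded_linear_compose[OF bounded_linear_cinner_left blinfun.bounded_linear_left])
  also have "\<dots> = (deriv ^^ n) (\<lambda>u. fact n * cinner (coef_rep n \<xi> u) \<eta>) 0"
  proof (rule higher_deriv_cong_ev[OF _ refl])
    show "\<forall>\<^sub>F u in nhds 0. cinner (blinfun_apply (?A u) \<xi>) \<eta> = fact n * cinner (coef_rep n \<xi> u) \<eta>"
      using eventually_nhds_in_open[of unit_disc 0] cinner_higher_deriv_zbar_kernel by (auto elim: eventually_mono)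
  qed
  also have "\<dots> = fact n * (deriv ^^ n) (\<lambda>u. cinner (coef_rep n \<xi> u) \<eta>) 0"
    by (rule higher_deriv_cmult[OF holomorphic_cinner[OF coef_rep_mem]]) auto
  also have "\<dots> = (fact n)\<^sup>2 * ip (coef_rep n \<xi>) (coef_rep n \<eta>)"
    by (simp add: ip_coef_rep[OF coef_rep_mem] coef_def power2_eq_square)
  finally show ?thesis .
qed

text \<open>The identity theorem is used one \<eta> at a time, on scalar functions; linearity and
  density of the span of \<open>E0\<close> then give f(z) = 0.\<close>

lemma coef_rep_total:
  assumes E0: "closure (cspan E0) = UNIV"
    and f: "f \<in> H" "\<And>n \<eta>. \<eta> \<in> E0 \<Longrightarrow> ip f (coef_rep n \<eta>) = 0"
  shows "f = 0"
proof
  fix z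
  show "f z = 0 z"
  proof (cases "z \<in> unit_disc")
    case True
    have E0': "cinner (f z) \<eta> = 0" if "\<eta> \<in> E0" for \<eta>
    proof (rule holomorphic_fun_eq_0_on_ball[OF holomorphic_cinner[OF f(1)] True])
      fix n
      show "(deriv ^^ n) (\<lambda>z. cinner (f z) \<eta>) 0 = 0"
        using f(2)[OF that, of n] ip_coef_rep[OF f(1)] by (simp add: coef_def)
    qed
    have "cinner (f z) \<eta> = 0" if "\<eta> \<in> cspan E0" for \<eta>
      using that
    proof (induction rule: complex_vector.span_induct_alt)
      case (step c x y)
      then show ?case by (simp add: cinner.ip_add_right cinner.ip_scale_right E0')
    qed simp
    then show ?thesis using eq_0_if_cinner_eq_0[OF E0] by simp
  qed (simp add: zero_off_disc f)
qed

text \<open>Kernel functions at a countable dense set of points, with vectors from a countable dense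
  set, are total: a member orthogonal to all of them vanishes at those points of the disc, hence
  everywhere on it by continuity.\<close>

lemma separable:
  assumes "separable_space (euclidean :: 'e topology)"
  shows "separable_space mtopology"
proof -
  obtain D :: "'e set" where D: "countable D" "closure D = UNIV"
    using assms unfolding separable_space_def by auto
  obtain W :: "complex set" where W: "countable W" "\<And>X. \<lbrakk>open X; X \<noteq> {}\<rbrakk> \<Longrightarrow> \<exists>w\<in>W. w \<in> X"
    using countable_dense_exists by metis
  define G where "G = (\<lambda>(w, \<eta>). kernel_fun K w \<eta>) ` ((W \<inter> unit_disc) \<times> D)"
  show ?thesis
  proof (rule separable_if_countable_total)
    show "G \<subseteq> H" by (auto simp: G_def intro!: kernel_mem)
    show "countable G"
      unfolding G_def using D(1) W(1) by (intro countable_image countable_SIGMA) auto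
    fix f assume f: "f \<in> H" and orth: "\<And>g. g \<in> G \<Longrightarrow> ip f g = 0"
    have fW: "f w = 0" if "w \<in> W" "w \<in> unit_disc" for w
    proof (rule eq_0_if_cinner_eq_0[OF D(2)])
      fix \<eta> assume "\<eta> \<in> D"
      then have "kernel_fun K w \<eta> \<in> G" using that by (auto simp: G_def)
      then show "cinner (f w) \<eta> = 0" using orth reproducing[OF f that(2)] by metis
    qed
    have "open (unit_disc \<inter> f -` (- {0}))"
      using continuous_on_vector_analytic[OF analytic[OF f]]
      by (rule continuous_open_preimage) auto
    then have "unit_disc \<inter> f -` (- {0}) = {}"
      using W(2) fW by (metis (no_types, lifting) ComplD IntD1 IntD2 singletonI vimageD)
    then have "f z = 0" for z
      using zero_off_disc[OF f, of z] by blast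
    then show "f = 0" by (simp add: fun_eq_iff)
  qed
qed

lemma coef_mult_z:
  assumes f: "f \<in> H"
  shows "coef (Suc n) \<eta> (mult_z f) = coef n \<eta> f" "coef 0 \<eta> (mult_z f) = 0"
proof -
  let ?g = "\<lambda>z. cinner (f z) \<eta>"
  have eq: "(\<lambda>z. cinner (mult_z f z) \<eta>) = (\<lambda>z. z * ?g z)"
    by (simp add: mult_z_def cinner_scaleC_left)
  have "(deriv ^^ Suc n) (\<lambda>z. z * ?g z) 0 =
      (\<Sum>i = 0..Suc n. of_nat (Suc n choose i) * (deriv ^^ i) (\<lambda>z. z) 0 * (deriv ^^ (Suc n - i)) ?g 0)"
    by (rule higher_deriv_mult[OF _ holomorphic_cinner[OF f]]) (auto intro: holomorphic_intros)
  \<comment> \<open>At 0 only the first derivative of the identity is nonzero, so one Leibniz term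
    survives; its factor n + 1 is absorbed by the change from n! to (n + 1)!.\<close>
  also have "\<dots> = (\<Sum>i = 0..Suc n. if i = 1 then of_nat (Suc n) * (deriv ^^ n) ?g 0 else 0)"
    by (intro sum.cong) auto
  also have "\<dots> = of_nat (Suc n) * (deriv ^^ n) ?g 0"
    by simp
  finally show "coef (Suc n) \<eta> (mult_z f) = coef n \<eta> f"
    unfolding coef_def eq by (simp add: divide_simps del: of_nat_Suc funpow.simps)
  show "coef 0 \<eta> (mult_z f) = 0" by (simp add: coef_def eq)
qed

section \<open>The adjoint of multiplication by z\<close>

context
  assumes bounded_mult_z: "bounded_operator_on H ip mult_z"
begin

lemma adjoint_coef_rep:
  "adjoint_on H ip mult_z (coef_rep (Suc n) \<eta>) = coef_rep n \<eta>"
  "adjoint_on H ip mult_z (coef_rep 0 \<eta>) = 0"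
  by (intro ip_eqI; simp add: adjoint_on_mem[OF bounded_mult_z] coef_rep_mem
      ip_adjoint_on[OF bounded_mult_z] ip_coef_rep operator_mem[OF bounded_mult_z] coef_mult_z)+

lemma adjoint_mult_z_transitive:
  assumes E0: "closure (cspan E0) = UNIV" and r: "strict_mono r"
    and lim: "\<And>\<eta>. \<eta> \<in> E0 \<Longrightarrow>
      (\<lambda>m. 1 / (fact (r m))\<^sup>2 * cinner (blinfun_apply (mixed_deriv (r m) K 0 0) \<eta>) \<eta>) \<longlonglongrightarrow> 0"
    and UV: "openin mtopology U" "U \<noteq> {}" "openin mtopology V" "V \<noteq> {}"
  shows "\<exists>s N. \<forall>m\<ge>N. s \<le> r m \<and> (\<exists>x\<in>V. (adjoint_on H ip mult_z ^^ (r m - s)) x \<in> U)"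
proof (rule backward_shift_transitive[where I = E0 and k = coef_rep, OF _ _ _ _ _ r _ UV])
  show "bounded_operator_on H ip (adjoint_on H ip mult_z)"
    by (rule bounded_operator_on_adjoint[OF bounded_mult_z])
  show "x = 0" if "x \<in> H" "\<And>n \<eta>. \<eta> \<in> E0 \<Longrightarrow> ip x (coef_rep n \<eta>) = 0" for x
    using coef_rep_total[OF E0] that by blast
  show "(\<lambda>m. nrm (coef_rep (r m) \<eta>)) \<longlonglongrightarrow> 0" if "\<eta> \<in> E0" for \<eta>
  proof -
    have "1 / (fact n)\<^sup>2 * cinner (blinfun_apply (mixed_deriv n K 0 0) \<eta>) \<eta> = of_real ((nrm (coef_rep n \<eta>))\<^sup>2)" for n
      by (simp add: cinner_mixed_deriv ip_self[OF coef_rep_mem])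
    then have "(\<lambda>m. of_real ((nrm (coef_rep (r m) \<eta>))\<^sup>2) :: complex) \<longlonglongrightarrow> of_real 0"
      using lim[OF that] by simp
    then have "(\<lambda>m. (nrm (coef_rep (r m) \<eta>))\<^sup>2) \<longlonglongrightarrow> 0"
      unfolding tendsto_of_real_iff .
    then have "(\<lambda>m. sqrt ((nrm (coef_rep (r m) \<eta>))\<^sup>2)) \<longlonglongrightarrow> sqrt 0"
      by (rule tendsto_real_sqrt)
    then show ?thesis by (simp add: coef_rep_mem)
  qed
qed (simp_all add: coef_rep_mem adjoint_coef_rep)

end
end

theorem theorem4p1:
  fixes K :: "complex \<Rightarrow> complex \<Rightarrow> ('e::chilbert_space \<Rightarrow>\<^sub>L 'e)"
    and E0 :: "'e set"
    and H :: "(complex \<Rightarrow> 'e) set"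
    and ip :: "(complex \<Rightarrow> 'e) \<Rightarrow> (complex \<Rightarrow> 'e) \<Rightarrow> complex"
  assumes "separable_space (euclidean :: 'e topology)"
    and "closure (cspan E0) = UNIV"
    and "analytic_kernel K"
    and "analytic_rkhs K H ip"
    and "bounded_operator_on H ip mult_z"
  shows "(liminf_zero_uniformly_on E0
            (\<lambda>n \<eta>. 1 / (fact n)\<^sup>2 * cinner (blinfun_apply (mixed_deriv n K 0 0) \<eta>) \<eta>)
          \<longrightarrow> hypercyclic_on (ip_topology H ip) (adjoint_on H ip mult_z)) \<and>
         ((\<forall>\<eta>\<in>E0. (\<lambda>n. 1 / (fact n)\<^sup>2 * cinner (blinfun_apply (mixed_deriv n K 0 0) \<eta>) \<eta>)
            \<longlonglongrightarrow> 0)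
          \<longrightarrow> topologically_mixing_on (ip_topology H ip) (adjoint_on H ip mult_z))"
proof (intro conjI impI)
  interpret rkhs K H ip using assms(4) by unfold_locales
  let ?T = "adjoint_on H ip mult_z"
  let ?u = "\<lambda>n \<eta>. 1 / (fact n)\<^sup>2 * cinner (blinfun_apply (mixed_deriv n K 0 0) \<eta>) \<eta>"
  note transitive = adjoint_mult_z_transitive[OF assms(5) assms(2)]
  {
    assume "liminf_zero_uniformly_on E0 ?u"
    then obtain r where r: "strict_mono r" and unif: "uniform_limit E0 (\<lambda>k. ?u (r k)) (\<lambda>_. 0) sequentially"
      unfolding liminf_zero_uniformly_on_def by blast
    have lim: "(\<lambda>k. ?u (r k) \<eta>) \<longlonglongrightarrow> 0" if "\<eta> \<in> E0" for \<eta>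
      using tendsto_uniform_limitI[OF unif that] .
    show "hypercyclic_on mtopology ?T"
    proof (rule hypercyclic_on_if_transitive[OF mcomplete separable[OF assms(1)]])
      show "H \<noteq> {}" using zero_mem by blast
      show "continuous_map mtopology mtopology ?T"
        by (rule continuous_map_operator[OF bounded_operator_on_adjoint[OF assms(5)]])
      show "\<exists>j. \<exists>x\<in>V. (?T ^^ j) x \<in> U"
        if "openin mtopology U" "openin mtopology V" "U \<noteq> {}" "V \<noteq> {}" for U V
        using transitive[OF r lim that(1,3,2,4)] by blast
    qed
  next
    assume lim: "\<forall>\<eta>\<in>E0. (\<lambda>n. ?u n \<eta>) \<longlonglongrightarrow> 0"
    show "topologically_mixing_on mtopology ?T"
      unfolding topologically_mixing_on_def
    proof (intro allI impI, elim conjE)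
      fix U V assume UV: "openin mtopology U" "openin mtopology V" "U \<noteq> {}" "V \<noteq> {}"
      \<comment> \<open>Here the exponent sequence is the identity, so \<open>m - s\<close> runs
        through all large integers, as mixing demands.\<close>
      obtain s N where sN: "\<And>m. m \<ge> N \<Longrightarrow> \<exists>x\<in>V. (?T ^^ (m - s)) x \<in> U"
        using transitive[OF strict_mono_id, of U V] lim UV unfolding id_apply by blast
      have "{x \<in> topspace mtopology. (?T ^^ j) x \<in> U} \<inter> V \<noteq> {}" if "j \<ge> N" for j
        using sN[of "j + s"] that openin_subset[OF UV(2)] by auto
      then show "\<exists>N. \<forall>j\<ge>N. {x \<in> topspace mtopology. (?T ^^ j) x \<in> U} \<inter> V \<noteq> {}" by blast
    qed
  }
qed

end
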